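(* Let $\mathcal{X}$ and $\mathcal{Y}$ be infinite dimensional complex Banach spaces and let $A\in B(\mathcal{X})$ and $B\in B(\mathcal{Y})$ be two operators that satisfy the generalized Browder's theorem. (a) If $\sigma(A)\sigma_{BW}(B)\cup\sigma_{BW}(A)\sigma(B)\subseteq\sigma_{BW}(A\otimes B)$, then $A\otimes B\in B(\mathcal{X}\overline{\otimes}\mathcal{Y})$ satisfies the generalized Browder's theorem. (b) If $\sigma(A)\sigma_{BW}(B)\cup\sigma_{BW}(A)\sigma(B)\subseteq\sigma_{BW}(\tau_{AB})$, then $\tau_{AB}\in B(B(\mathcal{Y},\mathcal{X}))$ satisfies the generalized Browder's theorem.
   Context: $B(\mathcal{Y},\mathcal{X})$ is the space of bounded linear maps from $\mathcal{Y}$ to $\mathcal{X}$, and $B(\mathcal{X})=B(\mathcal{X},\mathcal{X})$. $\mathcal{X}\overline{\otimes}\mathcal{Y}$ is the completion of the algebraic tensor product $\mathcal{X}\otimes\mathcal{Y}$ with respect to a reasonable uniform cross-norm (in particular $\|x\otimes y\|=\|x\|\,\|y\|$, and $A\otimes B$ extends to a bounded operator on the completion with $\|A\otimes B\|\le\|A\|\,\|B\|$, for all bounded $A$ on $\mathcal{X}$ and $B$ on $\mathcal{Y}$). $A\otimes B$ denotes this tensor product operator. $\tau_{AB}\in B(B(\mathcal{Y},\mathcal{X}))$ is the multiplication operator $\tau_{AB}(U)=AUB$. For subsets $K,K'$ of $\mathbb{C}$, $KK'=\{kk'\colon k\in K,\ k'\in K'\}$ (empty if either set is empty). A bounded operator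 $T$ on a Banach space $\mathcal{Z}$ is Weyl if $\dim N(T)$ and $\dim \mathcal{Z}/R(T)$ are finite and equal, where $N$ and $R$ denote null space and range. $T$ is B-Weyl if there is $n\in\mathbb{N}$ such that $R(T^n)$ is closed and the operator induced by $T$ on $R(T^n)$ is Weyl. $\sigma_{BW}(T)=\{\lambda\in\mathbb{C}\colon T-\lambda \text{ is not B-Weyl}\}$. The ascent (descent) of $T$ is the smallest integer $n\ge 0$ with $N(T^n)=N(T^{n+1})$ (respectively $R(T^n)=R(T^{n+1})$), or $\infty$ if there is none. $\Pi(T)$ is the set of poles of $T$: those $\lambda\in\sigma(T)$ such that the ascent and the descent of $T-\lambda$ are finite. $T$ satisfies the generalized Browder's theorem if $\sigma_{BW}(T)=\sigma(T)\setminus\Pi(T)$. *)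

theory Defs
  imports "HOL-Analysis.Analysis"
begin

section \<open>Complex Banach spaces\<close>

class scaleC =
  fixes scaleC :: "complex \<Rightarrow> 'a \<Rightarrow> 'a"  (infixr \<open>*\<^sub>C\<close> 75)

class complex_vector = real_vector + scaleC +
  assumes scaleC_add_right: "c *\<^sub>C (x + y) = c *\<^sub>C x + c *\<^sub>C y"
    and scaleC_add_left: "(c + d) *\<^sub>C x = c *\<^sub>C x + d *\<^sub>C x"
    and scaleC_scaleC: "c *\<^sub>C (d *\<^sub>C x) = (c * d) *\<^sub>C x"
    and scaleC_one: "1 *\<^sub>C x = x"
    and scaleR_scaleC: "r *\<^sub>R x = complex_of_real r *\<^sub>C x"

class complex_normed_vector = complex_vector + real_normed_vector +
  assumes norm_scaleC: "norm (c *\<^sub>C x) = cmod c * norm x"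

class cbanach = complex_normed_vector + banach

interpretation complex_vector: vector_space "scaleC :: complex \<Rightarrow> 'a \<Rightarrow> 'a::complex_vector"
  by standard (simp_all add: scaleC_add_right scaleC_add_left scaleC_scaleC scaleC_one)

instantiation complex :: cbanach
begin

definition scaleC_complex :: "complex \<Rightarrow> complex \<Rightarrow> complex"
  where "scaleC_complex c z = c * z"

instance
  by standard (simp_all add: scaleC_complex_def algebra_simps norm_mult scaleR_conv_of_real)

end

lemma bounded_linear_scaleC: "bounded_linear (\<lambda>x::'a::complex_normed_vector. c *\<^sub>C x)"
  by (rule bounded_linear_intro[where K = "cmod c"])
    (simp_all add: scaleC_add_right norm_scaleC scaleR_scaleC scaleC_scaleC mult.commute)


section \<open>Bounded complex-linear maps\<close>

typedef (overloaded) ('a, 'b) cblinfun =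
  "{f :: 'a::complex_normed_vector \<Rightarrow>\<^sub>L 'b::complex_normed_vector.
      \<forall>c x. blinfun_apply f (c *\<^sub>C x) = c *\<^sub>C blinfun_apply f x}"
  morphisms blinfun_of_cblinfun CBlinfun
  by (rule exI[of _ 0]) simp

setup_lifting type_definition_cblinfun

lift_definition cblinfun_apply ::
  "('a::complex_normed_vector, 'b::complex_normed_vector) cblinfun \<Rightarrow> 'a \<Rightarrow> 'b"
  is blinfun_apply .

lemma cblinfun_eqI: "(\<And>x. cblinfun_apply f x = cblinfun_apply g x) \<Longrightarrow> f = g"
  by transfer (rule blinfun_eqI)

text \<open>The norm is the operator norm inherited from \<^typ>\<open>'a \<Rightarrow>\<^sub>L 'b\<close>.\<close>

instantiation cblinfun :: (complex_normed_vector, complex_normed_vector) complex_normed_vector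
begin

lift_definition norm_cblinfun :: "('a, 'b) cblinfun \<Rightarrow> real" is norm .

lift_definition zero_cblinfun :: "('a, 'b) cblinfun" is 0
  by simp

lift_definition plus_cblinfun :: "('a, 'b) cblinfun \<Rightarrow> ('a, 'b) cblinfun \<Rightarrow> ('a, 'b) cblinfun"
  is "(+)"
  by (simp add: blinfun.add_left scaleC_add_right)

lift_definition minus_cblinfun :: "('a, 'b) cblinfun \<Rightarrow> ('a, 'b) cblinfun \<Rightarrow> ('a, 'b) cblinfun"
  is "(-)"
  by (simp add: blinfun.diff_left complex_vector.scale_right_diff_distrib)

lift_definition uminus_cblinfun :: "('a, 'b) cblinfun \<Rightarrow> ('a, 'b) cblinfun"
  is uminus
  by (simp add: blinfun.minus_left)

lift_definition scaleR_cblinfun :: "real \<Rightarrow> ('a, 'b) cblinfun \<Rightarrow> ('a, 'b) cblinfun"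
  is scaleR
  by (simp add: blinfun.scaleR_left scaleR_scaleC scaleC_scaleC mult.commute)

lift_definition scaleC_cblinfun :: "complex \<Rightarrow> ('a, 'b) cblinfun \<Rightarrow> ('a, 'b) cblinfun"
  is "\<lambda>c f. Blinfun (\<lambda>x. c *\<^sub>C blinfun_apply f x)"
  by (simp add: bounded_linear_Blinfun_apply
      bounded_linear_compose[OF bounded_linear_scaleC blinfun.bounded_linear_right]
      scaleC_scaleC mult.commute)

definition dist_cblinfun :: "('a, 'b) cblinfun \<Rightarrow> ('a, 'b) cblinfun \<Rightarrow> real"
  where "dist_cblinfun f g = norm (f - g)"

definition uniformity_cblinfun :: "(('a, 'b) cblinfun \<times> ('a, 'b) cblinfun) filter"
  where "uniformity_cblinfun = (INF e\<in>{0<..}. principal {(f, g). dist f g < e})"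

definition open_cblinfun :: "('a, 'b) cblinfun set \<Rightarrow> bool"
  where "open_cblinfun S = (\<forall>f\<in>S. \<forall>\<^sub>F (f', g) in uniformity. f' = f \<longrightarrow> g \<in> S)"

definition sgn_cblinfun :: "('a, 'b) cblinfun \<Rightarrow> ('a, 'b) cblinfun"
  where "sgn_cblinfun f = inverse (norm f) *\<^sub>R f"

lemma cblinfun_apply_scaleC: "cblinfun_apply (c *\<^sub>C f) x = c *\<^sub>C cblinfun_apply f x"
  by transfer (simp add: bounded_linear_Blinfun_apply
      bounded_linear_compose[OF bounded_linear_scaleC blinfun.bounded_linear_right])

lemma cblinfun_apply_add: "cblinfun_apply (f + g) x = cblinfun_apply f x + cblinfun_apply g x"
  by transfer (simp add: blinfun.add_left)

lemma cblinfun_apply_diff: "cblinfun_apply (f - g) x = cblinfun_apply f x - cblinfun_apply g x"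
  by transfer (simp add: blinfun.diff_left)

lemma cblinfun_apply_scaleR: "cblinfun_apply (r *\<^sub>R f) x = r *\<^sub>R cblinfun_apply f x"
  by transfer (simp add: blinfun.scaleR_left)

lemma norm_cblinfun: "norm (cblinfun_apply f x) \<le> norm f * norm x"
  by transfer (rule norm_blinfun)

lemma norm_cblinfun_bound:
  "0 \<le> b \<Longrightarrow> (\<And>x. norm (cblinfun_apply f x) \<le> b * norm x) \<Longrightarrow> norm f \<le> b"
  by transfer (rule norm_blinfun_bound)

instance
proof
  fix f g h :: "('a, 'b) cblinfun" and r s :: real and c d :: complex
  show "f + g + h = f + (g + h)" "f + g = g + f" "0 + f = f" "- f + f = 0" "f - g = f + - g"
    by (transfer; simp)+
  show "r *\<^sub>R (f + g) = r *\<^sub>R f + r *\<^sub>R g" "(r + s) *\<^sub>R f = r *\<^sub>R f + s *\<^sub>R f"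
    "r *\<^sub>R s *\<^sub>R f = (r * s) *\<^sub>R f" "1 *\<^sub>R f = f"
    by (transfer; simp add: algebra_simps)+
  show "c *\<^sub>C (f + g) = c *\<^sub>C f + c *\<^sub>C g" "(c + d) *\<^sub>C f = c *\<^sub>C f + d *\<^sub>C f"
    "c *\<^sub>C d *\<^sub>C f = (c * d) *\<^sub>C f" "1 *\<^sub>C f = f" "r *\<^sub>R f = complex_of_real r *\<^sub>C f"
    by (rule cblinfun_eqI, simp add: cblinfun_apply_scaleC cblinfun_apply_add cblinfun_apply_scaleR
        scaleC_add_right scaleC_add_left scaleC_scaleC scaleC_one scaleR_scaleC)+
  show "dist f g = norm (f - g)"
    by (rule dist_cblinfun_def)
  show "sgn f = inverse (norm f) *\<^sub>R f"
    by (rule sgn_cblinfun_def)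
  show "(uniformity :: (('a, 'b) cblinfun \<times> ('a, 'b) cblinfun) filter)
      = (INF e\<in>{0<..}. principal {(f, g). dist f g < e})"
    by (rule uniformity_cblinfun_def)
  show "open U = (\<forall>f\<in>U. \<forall>\<^sub>F (f', g) in uniformity. f' = f \<longrightarrow> g \<in> U)"
    for U :: "('a, 'b) cblinfun set"
    by (rule open_cblinfun_def)
  show "(norm f = 0) = (f = 0)"
    by transfer simp
  show "norm (f + g) \<le> norm f + norm g"
    by transfer (rule norm_triangle_ineq)
  show "norm (r *\<^sub>R f) = \<bar>r\<bar> * norm f"
    by transfer simp
  have le: "norm (a *\<^sub>C k) \<le> cmod a * norm k" for a and k :: "('a, 'b) cblinfun"
  proof (rule norm_cblinfun_bound)
    show "0 \<le> cmod a * norm k"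
      by (transfer, simp)
    show "norm (cblinfun_apply (a *\<^sub>C k) x) \<le> cmod a * norm k * norm x" for x
      using mult_left_mono[OF norm_cblinfun[of k x] norm_ge_zero[of a]]
      by (simp add: cblinfun_apply_scaleC norm_scaleC mult.assoc)
  qed
  show "norm (c *\<^sub>C f) = cmod c * norm f"
  proof (cases "c = 0")
    case True
    have "0 *\<^sub>C f = 0"
      by (rule cblinfun_eqI) (simp add: cblinfun_apply_scaleC, transfer, simp)
    moreover have "norm (0 :: ('a, 'b) cblinfun) = 0"
      by transfer simp
    ultimately show ?thesis using True by simp
  next
    case False
    have "inverse c *\<^sub>C c *\<^sub>C f = f"
      by (rule cblinfun_eqI) (simp add: cblinfun_apply_scaleC scaleC_scaleC scaleC_one False)
    then have "norm f \<le> cmod (inverse c) * norm (c *\<^sub>C f)"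
      using le[of "inverse c" "c *\<^sub>C f"] by simp
    then have "cmod c * norm f \<le> norm (c *\<^sub>C f)"
      using False by (simp add: norm_inverse norm_divide field_simps)
    then show ?thesis using le[of c f] by simp
  qed
qed

end

instance cblinfun :: (complex_normed_vector, cbanach) cbanach
proof
  fix X :: "nat \<Rightarrow> ('a, 'b) cblinfun"
  assume "Cauchy X"
  have dist: "dist (blinfun_of_cblinfun f) (blinfun_of_cblinfun g) = dist f g"
    for f g :: "('a, 'b) cblinfun"
    unfolding dist_norm by transfer simp
  have "Cauchy (\<lambda>n. blinfun_of_cblinfun (X n))"
    using \<open>Cauchy X\<close> by (simp add: Cauchy_def dist)
  then obtain L where L: "(\<lambda>n. blinfun_of_cblinfun (X n)) \<longlonglongrightarrow> L"
    using Cauchy_convergent convergent_def by blast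
  have app: "(\<lambda>n. blinfun_apply (blinfun_of_cblinfun (X n)) x) \<longlonglongrightarrow> blinfun_apply L x" for x
    by (intro tendsto_intros L)
  have "blinfun_apply L (c *\<^sub>C x) = c *\<^sub>C blinfun_apply L x" for c x
  proof (rule LIMSEQ_unique[OF app])
    have "blinfun_apply (blinfun_of_cblinfun (X n)) (c *\<^sub>C x)
        = c *\<^sub>C blinfun_apply (blinfun_of_cblinfun (X n)) x" for n
      using blinfun_of_cblinfun[of "X n"] by simp
    then show "(\<lambda>n. blinfun_apply (blinfun_of_cblinfun (X n)) (c *\<^sub>C x))
        \<longlonglongrightarrow> c *\<^sub>C blinfun_apply L x"
      using bounded_linear.tendsto[OF bounded_linear_scaleC app] by simp
  qed
  then have "L = blinfun_of_cblinfun (CBlinfun L)"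
    by (simp add: CBlinfun_inverse)
  then have "X \<longlonglongrightarrow> CBlinfun L"
    using L dist by (metis (no_types, lifting) LIMSEQ_def)
  then show "convergent X"
    unfolding convergent_def by blast
qed

lift_definition cblinfun_id :: "('a::complex_normed_vector, 'a) cblinfun" is id_blinfun
  by simp

lift_definition cblinfun_compose ::
  "('b::complex_normed_vector, 'c::complex_normed_vector) cblinfun \<Rightarrow>
   ('a::complex_normed_vector, 'b) cblinfun \<Rightarrow> ('a, 'c) cblinfun"  (infixl \<open>o\<^sub>C\<close> 67)
  is blinfun_compose
  by simp

lemma norm_cblinfun_compose: "norm (f o\<^sub>C g) \<le> norm f * norm g"
  by transfer (rule norm_blinfun_compose)

lemma cblinfun_apply_compose: "cblinfun_apply (f o\<^sub>C g) x = cblinfun_apply f (cblinfun_apply g x)"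
  by transfer simp

lemma bounded_linear_cblinfun_apply: "bounded_linear (cblinfun_apply f)"
  by transfer (rule blinfun.bounded_linear_right)

lemma cblinfun_apply_scaleC_right: "cblinfun_apply f (c *\<^sub>C x) = c *\<^sub>C cblinfun_apply f x"
  by transfer simp

lemma cblinfun_exI:
  assumes "bounded_linear f" and "\<And>c x. f (c *\<^sub>C x) = c *\<^sub>C f x"
  shows "\<exists>F. cblinfun_apply F = f"
proof
  have "Blinfun f \<in> {g. \<forall>c x. blinfun_apply g (c *\<^sub>C x) = c *\<^sub>C blinfun_apply g x}"
    using assms by (simp add: bounded_linear_Blinfun_apply)
  then show "cblinfun_apply (CBlinfun (Blinfun f)) = f"
    using assms by (simp add: cblinfun_apply.rep_eq CBlinfun_inverse bounded_linear_Blinfun_apply)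
qed

definition mult_op ::
  "('x::complex_normed_vector, 'x) cblinfun \<Rightarrow> ('y::complex_normed_vector, 'y) cblinfun \<Rightarrow>
   (('y, 'x) cblinfun, ('y, 'x) cblinfun) cblinfun" where
  "mult_op A B = CBlinfun (Blinfun (\<lambda>U. A o\<^sub>C U o\<^sub>C B))"

lemma mult_op_apply:
  fixes A :: "('x::complex_normed_vector, 'x) cblinfun"
    and B :: "('y::complex_normed_vector, 'y) cblinfun"
  shows "cblinfun_apply (mult_op A B) U = A o\<^sub>C U o\<^sub>C B"
proof -
  have lin: "A o\<^sub>C (c *\<^sub>C U) o\<^sub>C B = c *\<^sub>C (A o\<^sub>C U o\<^sub>C B)" for c U
    by (rule cblinfun_eqI)
      (simp add: cblinfun_apply_compose cblinfun_apply_scaleC cblinfun_apply_scaleC_right)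
  have "bounded_linear (\<lambda>U. A o\<^sub>C U o\<^sub>C B)"
  proof (rule bounded_linear_intro[where K = "norm A * norm B"])
    show "A o\<^sub>C (U + V) o\<^sub>C B = (A o\<^sub>C U o\<^sub>C B) + (A o\<^sub>C V o\<^sub>C B)" for U V
      by (rule cblinfun_eqI)
        (simp add: cblinfun_apply_compose cblinfun_apply_add
          linear_add[OF bounded_linear.linear[OF bounded_linear_cblinfun_apply]])
    show "A o\<^sub>C (r *\<^sub>R U) o\<^sub>C B = r *\<^sub>R (A o\<^sub>C U o\<^sub>C B)" for r U
      by (simp add: scaleR_scaleC lin)
    show "norm (A o\<^sub>C U o\<^sub>C B) \<le> norm U * (norm A * norm B)" for U
    proof -
      have "norm (A o\<^sub>C U o\<^sub>C B) \<le> norm (A o\<^sub>C U) * norm B"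
        by (rule norm_cblinfun_compose)
      also have "\<dots> \<le> (norm A * norm U) * norm B"
        by (intro mult_right_mono norm_cblinfun_compose norm_ge_zero)
      finally show ?thesis by (simp add: mult_ac)
    qed
  qed
  with lin show ?thesis
    by (simp add: mult_op_def cblinfun_apply.rep_eq CBlinfun_inverse bounded_linear_Blinfun_apply)
qed


section \<open>Spectra\<close>

definition cspectrum :: "('z::complex_normed_vector, 'z) cblinfun \<Rightarrow> complex set" where
  "cspectrum T = {\<mu>. \<not> (\<exists>S. S o\<^sub>C (T - \<mu> *\<^sub>C cblinfun_id) = cblinfun_id
                         \<and> (T - \<mu> *\<^sub>C cblinfun_id) o\<^sub>C S = cblinfun_id)}"

definition null_pow :: "('z::complex_normed_vector, 'z) cblinfun \<Rightarrow> nat \<Rightarrow> 'z set" where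
  "null_pow T n = {x. (cblinfun_apply T ^^ n) x = 0}"

definition range_pow :: "('z::complex_normed_vector, 'z) cblinfun \<Rightarrow> nat \<Rightarrow> 'z set" where
  "range_pow T n = range (cblinfun_apply T ^^ n)"

definition has_cdim :: "'z::complex_vector set \<Rightarrow> nat \<Rightarrow> bool" where
  "has_cdim V n \<longleftrightarrow> (\<exists>E. finite E \<and> card E = n \<and>
      complex_vector.independent E \<and> complex_vector.span E = V)"

text \<open>
  For subspaces \<open>W \<subseteq> V\<close>: the quotient space \<open>V / W\<close> has finite dimension \<open>n\<close>. The set \<open>E\<close>
  contains one representative of each element of a basis of \<open>V / W\<close>, that is, the cosets of the
  elements of \<open>E\<close> are linearly independent and span \<open>V / W\<close>.
\<close>

definition has_quotient_cdim :: "'z::complex_vector set \<Rightarrow> 'z set \<Rightarrow> nat \<Rightarrow> bool" where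
  "has_quotient_cdim V W n \<longleftrightarrow> (\<exists>E\<subseteq>V. finite E \<and> card E = n \<and>
      (\<forall>a. (\<Sum>e\<in>E. a e *\<^sub>C e) \<in> W \<longrightarrow> (\<forall>e\<in>E. a e = 0)) \<and>
      (\<forall>v\<in>V. \<exists>a. v - (\<Sum>e\<in>E. a e *\<^sub>C e) \<in> W))"

text \<open>The restriction of \<open>T\<close> to an invariant subspace \<open>M\<close>, as an operator on \<open>M\<close>, is Weyl.\<close>

definition weyl_on :: "'z::complex_normed_vector set \<Rightarrow> ('z, 'z) cblinfun \<Rightarrow> bool" where
  "weyl_on M T \<longleftrightarrow> (\<exists>n. has_cdim {x \<in> M. cblinfun_apply T x = 0} n
                        \<and> has_quotient_cdim M (cblinfun_apply T ` M) n)"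

definition B_weyl :: "('z::complex_normed_vector, 'z) cblinfun \<Rightarrow> bool" where
  "B_weyl T \<longleftrightarrow> (\<exists>n. closed (range_pow T n) \<and> weyl_on (range_pow T n) T)"

definition B_weyl_spectrum :: "('z::complex_normed_vector, 'z) cblinfun \<Rightarrow> complex set" where
  "B_weyl_spectrum T = {\<mu>. \<not> B_weyl (T - \<mu> *\<^sub>C cblinfun_id)}"

text \<open>The infimum of the empty set is \<open>\<infinity>\<close>.\<close>

definition ascent :: "('z::complex_normed_vector, 'z) cblinfun \<Rightarrow> enat" where
  "ascent T = Inf {enat n | n. null_pow T n = null_pow T (n + 1)}"

definition descent :: "('z::complex_normed_vector, 'z) cblinfun \<Rightarrow> enat" where
  "descent T = Inf {enat n | n. range_pow T n = range_pow T (n + 1)}"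

definition poles :: "('z::complex_normed_vector, 'z) cblinfun \<Rightarrow> complex set" where
  "poles T = {\<mu> \<in> cspectrum T. ascent (T - \<mu> *\<^sub>C cblinfun_id) < \<infinity>
                            \<and> descent (T - \<mu> *\<^sub>C cblinfun_id) < \<infinity>}"

definition generalized_browder :: "('z::complex_normed_vector, 'z) cblinfun \<Rightarrow> bool" where
  "generalized_browder T \<longleftrightarrow> B_weyl_spectrum T = cspectrum T - poles T"


section \<open>Tensor products\<close>

text \<open>
  The algebraic tensor product is realised as a space of linear functionals on the space of
  bilinear forms on \<open>'a \<times> 'b\<close>: the elementary tensor of \<open>x\<close> and \<open>y\<close> is the evaluation
  \<open>\<beta> \<mapsto> \<beta> x y\<close>, and the tensor product is the linear span of these evaluations. Functions that are
  not bilinear forms are mapped to \<open>0\<close> as a dummy value.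
\<close>

definition bilinear_form :: "('a::complex_vector \<Rightarrow> 'b::complex_vector \<Rightarrow> complex) \<Rightarrow> bool" where
  "bilinear_form \<beta> \<longleftrightarrow> (\<forall>y. Vector_Spaces.linear scaleC scaleC (\<lambda>x. \<beta> x y))
                     \<and> (\<forall>x. Vector_Spaces.linear scaleC scaleC (\<lambda>y. \<beta> x y))"

definition tensor_sum ::
  "('a::complex_vector \<times> 'b::complex_vector) list \<Rightarrow> ('a \<Rightarrow> 'b \<Rightarrow> complex) \<Rightarrow> complex" where
  "tensor_sum xs \<beta> = (if bilinear_form \<beta> then (\<Sum>(x, y)\<leftarrow>xs. \<beta> x y) else 0)"

lemma bilinear_form_simps:
  assumes "bilinear_form \<beta>"
  shows "\<beta> (x + x') y = \<beta> x y + \<beta> x' y" "\<beta> x (y + y') = \<beta> x y + \<beta> x y'"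
    "\<beta> (c *\<^sub>C x) y = c * \<beta> x y" "\<beta> x (c *\<^sub>C y) = c * \<beta> x y"
proof -
  have l: "Vector_Spaces.linear scaleC scaleC (\<lambda>x. \<beta> x y)"
    and r: "Vector_Spaces.linear scaleC scaleC (\<lambda>y. \<beta> x y)" for x y
    using assms by (auto simp: bilinear_form_def)
  show "\<beta> (x + x') y = \<beta> x y + \<beta> x' y" "\<beta> (c *\<^sub>C x) y = c * \<beta> x y"
    using Vector_Spaces.linear.axioms(3)[OF l]
    by (simp_all add: module_hom_iff scaleC_complex_def)
  show "\<beta> x (y + y') = \<beta> x y + \<beta> x y'" "\<beta> x (c *\<^sub>C y) = c * \<beta> x y"
    using Vector_Spaces.linear.axioms(3)[OF r]
    by (simp_all add: module_hom_iff scaleC_complex_def)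
qed

lemma bilinear_formI:
  fixes \<beta> :: "'a::complex_vector \<Rightarrow> 'b::complex_vector \<Rightarrow> complex"
  assumes "\<And>x x' y. \<beta> (x + x') y = \<beta> x y + \<beta> x' y" "\<And>x y y'. \<beta> x (y + y') = \<beta> x y + \<beta> x y'"
    "\<And>c x y. \<beta> (c *\<^sub>C x) y = c * \<beta> x y" "\<And>c x y. \<beta> x (c *\<^sub>C y) = c * \<beta> x y"
  shows "bilinear_form \<beta>"
  unfolding bilinear_form_def Vector_Spaces.linear_def module_hom_iff
  using assms
  by (auto simp: scaleC_complex_def complex_vector.vector_space_axioms complex_vector.module_axioms)

lemma tensor_sum_scale:
  "tensor_sum (map (\<lambda>(x, y). (c *\<^sub>C x, y)) xs) \<beta> = c * tensor_sum xs \<beta>"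
  unfolding tensor_sum_def
  by (induction xs) (auto simp: bilinear_form_simps algebra_simps)

lemma tensor_sum_append: "tensor_sum (xs @ ys) \<beta> = tensor_sum xs \<beta> + tensor_sum ys \<beta>"
  by (simp add: tensor_sum_def)

typedef (overloaded) ('a, 'b) ctensor =
  "range (tensor_sum :: ('a::complex_vector \<times> 'b::complex_vector) list \<Rightarrow> _)"
  morphisms ctensor_eval Abs_ctensor
  by blast

setup_lifting type_definition_ctensor

lemma ctensor_eqI: "(\<And>\<beta>. ctensor_eval u \<beta> = ctensor_eval v \<beta>) \<Longrightarrow> u = v"
  by (simp add: ctensor_eval_inject[symmetric] fun_eq_iff)

lemma ctensor_cases:
  obtains xs where "ctensor_eval u = tensor_sum xs"
  using ctensor_eval[of u] by blast

lift_definition tensor :: "'a::complex_vector \<Rightarrow> 'b::complex_vector \<Rightarrow> ('a, 'b) ctensor"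
    (infixr \<open>\<otimes>\<^sub>C\<close> 70)
  is "\<lambda>x y. tensor_sum [(x, y)]"
  by blast

instantiation ctensor :: (complex_vector, complex_vector) complex_vector
begin

lift_definition zero_ctensor :: "('a, 'b) ctensor" is "\<lambda>_. 0"
  by (rule range_eqI[of _ _ "[]"]) (simp add: tensor_sum_def fun_eq_iff)

lift_definition plus_ctensor :: "('a, 'b) ctensor \<Rightarrow> ('a, 'b) ctensor \<Rightarrow> ('a, 'b) ctensor"
  is "\<lambda>u v \<beta>. u \<beta> + v \<beta>"
  by (auto simp: tensor_sum_append[symmetric])

lift_definition scaleC_ctensor :: "complex \<Rightarrow> ('a, 'b) ctensor \<Rightarrow> ('a, 'b) ctensor"
  is "\<lambda>c u \<beta>. c * u \<beta>"
  by (auto simp: tensor_sum_scale[symmetric])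

definition scaleR_ctensor :: "real \<Rightarrow> ('a, 'b) ctensor \<Rightarrow> ('a, 'b) ctensor"
  where "scaleR_ctensor r u = complex_of_real r *\<^sub>C u"

definition uminus_ctensor :: "('a, 'b) ctensor \<Rightarrow> ('a, 'b) ctensor"
  where "uminus_ctensor u = (-1) *\<^sub>C u"

definition minus_ctensor :: "('a, 'b) ctensor \<Rightarrow> ('a, 'b) ctensor \<Rightarrow> ('a, 'b) ctensor"
  where "minus_ctensor u v = u + - v"

instance
  by standard
    (unfold scaleR_ctensor_def uminus_ctensor_def minus_ctensor_def,
      (transfer, simp add: algebra_simps fun_eq_iff)+)

end

lemma bilinear_form_compose:
  assumes "bilinear_form \<beta>"
  shows "bilinear_form (\<lambda>x y. \<beta> (cblinfun_apply A x) (cblinfun_apply B y))"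
  using assms
  by (intro bilinear_formI)
    (simp_all add: bilinear_form_simps cblinfun_apply_scaleC_right
      linear_add[OF bounded_linear.linear[OF bounded_linear_cblinfun_apply]])

text \<open>The operator \<open>A \<otimes> B\<close> on the algebraic tensor product, as characterised by the next lemma.\<close>

lift_definition ctensor_map ::
  "('a::complex_normed_vector, 'c::complex_normed_vector) cblinfun \<Rightarrow>
   ('b::complex_normed_vector, 'd::complex_normed_vector) cblinfun \<Rightarrow>
   ('a, 'b) ctensor \<Rightarrow> ('c, 'd) ctensor"
  is "\<lambda>A B u \<beta>. if bilinear_form \<beta>
        then u (\<lambda>x y. \<beta> (cblinfun_apply A x) (cblinfun_apply B y)) else 0"
proof -
  fix A :: "('a, 'c) cblinfun" and B :: "('b, 'd) cblinfun"
    and u :: "('a \<Rightarrow> 'b \<Rightarrow> complex) \<Rightarrow> complex"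
  assume "u \<in> range tensor_sum"
  then obtain xs where u: "u = tensor_sum xs" by blast
  show "(\<lambda>\<beta>. if bilinear_form \<beta> then u (\<lambda>x y. \<beta> (cblinfun_apply A x) (cblinfun_apply B y)) else 0)
      \<in> range tensor_sum"
    by (rule range_eqI[of _ _ "map (\<lambda>(x, y). (cblinfun_apply A x, cblinfun_apply B y)) xs"])
      (auto simp: u tensor_sum_def fun_eq_iff bilinear_form_compose o_def case_prod_unfold)
qed

lemma ctensor_map_tensor:
  "ctensor_map A B (x \<otimes>\<^sub>C y) = cblinfun_apply A x \<otimes>\<^sub>C cblinfun_apply B y"
  by (rule ctensor_eqI)
    (simp add: ctensor_map.rep_eq tensor.rep_eq tensor_sum_def bilinear_form_compose)

lemma ctensor_map_add: "ctensor_map A B (u + v) = ctensor_map A B u + ctensor_map A B v"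
  by (rule ctensor_eqI) (simp add: ctensor_map.rep_eq plus_ctensor.rep_eq)

lemma ctensor_map_scaleC: "ctensor_map A B (c *\<^sub>C u) = c *\<^sub>C ctensor_map A B u"
  by (rule ctensor_eqI) (simp add: ctensor_map.rep_eq scaleC_ctensor.rep_eq)

text \<open>The functional \<open>\<phi> \<otimes> \<psi>\<close> on the algebraic tensor product, mapping \<open>x \<otimes> y\<close> to \<open>\<phi> x * \<psi> y\<close>.\<close>

definition tensor_functional ::
  "('a::complex_normed_vector, complex) cblinfun \<Rightarrow> ('b::complex_normed_vector, complex) cblinfun \<Rightarrow>
   ('a, 'b) ctensor \<Rightarrow> complex" where
  "tensor_functional \<phi> \<psi> u = ctensor_eval u (\<lambda>x y. cblinfun_apply \<phi> x * cblinfun_apply \<psi> y)"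

lemma tensor_functional_tensor:
  "tensor_functional \<phi> \<psi> (x \<otimes>\<^sub>C y) = cblinfun_apply \<phi> x * cblinfun_apply \<psi> y"
proof -
  have "bilinear_form (\<lambda>x y. cblinfun_apply \<phi> x * cblinfun_apply \<psi> y)"
    by (intro bilinear_formI)
      (simp_all add: cblinfun_apply_scaleC_right scaleC_complex_def algebra_simps
        linear_add[OF bounded_linear.linear[OF bounded_linear_cblinfun_apply]])
  then show ?thesis
    by (simp add: tensor_functional_def tensor.rep_eq tensor_sum_def)
qed

definition is_cnorm :: "('v::complex_vector \<Rightarrow> real) \<Rightarrow> bool" where
  "is_cnorm \<alpha> \<longleftrightarrow> (\<forall>u. 0 \<le> \<alpha> u) \<and> (\<forall>u. \<alpha> u = 0 \<longrightarrow> u = 0) \<and>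
     (\<forall>c u. \<alpha> (c *\<^sub>C u) = cmod c * \<alpha> u) \<and> (\<forall>u v. \<alpha> (u + v) \<le> \<alpha> u + \<alpha> v)"

text \<open>
  A norm \<open>\<alpha>\<close> on \<open>X \<otimes> Y\<close> is a cross-norm if \<open>\<alpha> (x \<otimes> y) = \<parallel>x\<parallel> * \<parallel>y\<parallel>\<close>, it is reasonable if
  \<open>\<phi> \<otimes> \<psi>\<close> is bounded with norm at most \<open>\<parallel>\<phi>\<parallel> * \<parallel>\<psi>\<parallel>\<close> for all continuous functionals, and it is
  uniform if \<open>A \<otimes> B\<close> is bounded with norm at most \<open>\<parallel>A\<parallel> * \<parallel>B\<parallel>\<close> for all bounded operators.
\<close>

definition reasonable_uniform_crossnorm ::
  "(('x::complex_normed_vector, 'y::complex_normed_vector) ctensor \<Rightarrow> real) \<Rightarrow> bool" where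
  "reasonable_uniform_crossnorm \<alpha> \<longleftrightarrow> is_cnorm \<alpha> \<and>
     (\<forall>x y. \<alpha> (x \<otimes>\<^sub>C y) = norm x * norm y) \<and>
     (\<forall>\<phi> \<psi> u. cmod (tensor_functional \<phi> \<psi> u) \<le> norm \<phi> * norm \<psi> * \<alpha> u) \<and>
     (\<forall>A B u. \<alpha> (ctensor_map A B u) \<le> norm A * norm B * \<alpha> u)"

text \<open>
  A Banach space \<open>'z\<close> together with \<open>\<iota>\<close> is a completion of the normed space \<open>('v, \<alpha>)\<close> if \<open>\<iota>\<close> is an
  isometric linear embedding with dense range.
\<close>

definition is_completion :: "('v::complex_vector \<Rightarrow> real) \<Rightarrow> ('v \<Rightarrow> 'z::cbanach) \<Rightarrow> bool" where
  "is_completion \<alpha> \<iota> \<longleftrightarrow> Vector_Spaces.linear scaleC scaleC \<iota> \<and>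
     (\<forall>u. norm (\<iota> u) = \<alpha> u) \<and> closure (range \<iota>) = UNIV"

text \<open>The operator \<open>A \<otimes> B\<close> on the completion; well defined by \<open>tensor_op_ex1\<close> below.\<close>

definition tensor_op ::
  "(('x::cbanach, 'y::cbanach) ctensor \<Rightarrow> 'z::cbanach) \<Rightarrow> ('x, 'x) cblinfun \<Rightarrow> ('y, 'y) cblinfun \<Rightarrow>
   ('z, 'z) cblinfun" where
  "tensor_op \<iota> A B = (THE T. \<forall>x y. cblinfun_apply T (\<iota> (x \<otimes>\<^sub>C y)) =
                              \<iota> (cblinfun_apply A x \<otimes>\<^sub>C cblinfun_apply B y))"

lemma ctensor_induct:
  assumes "P 0" and "\<And>x y u. P u \<Longrightarrow> P (x \<otimes>\<^sub>C y + u)"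
  shows "P u"
proof -
  have "\<forall>u. ctensor_eval u = tensor_sum xs \<longrightarrow> P u" for xs
  proof (induction xs)
    case Nil
    have "u = 0" if "ctensor_eval u = tensor_sum []" for u :: "('a, 'b) ctensor"
      using that by (simp add: ctensor_eval_inject[symmetric] zero_ctensor.rep_eq tensor_sum_def
          fun_eq_iff)
    then show ?case using assms(1) by auto
  next
    case (Cons p xs)
    obtain x y where p: "p = (x, y)" by force
    show ?case
    proof (intro allI impI)
      fix u :: "('a, 'b) ctensor"
      assume u: "ctensor_eval u = tensor_sum (p # xs)"
      have ev: "ctensor_eval (Abs_ctensor (tensor_sum xs)) = tensor_sum xs"
        by (simp add: Abs_ctensor_inverse)
      have "u = x \<otimes>\<^sub>C y + Abs_ctensor (tensor_sum xs)"
        using tensor_sum_append[of "[p]" xs]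
        by (simp add: ctensor_eval_inject[symmetric] plus_ctensor.rep_eq ev u tensor.rep_eq p
            fun_eq_iff)
      then show "P u"
        using assms(2) Cons ev by metis
    qed
  qed
  then show ?thesis
    using ctensor_cases[of u] by metis
qed

lemma tensor_op_ex1:
  fixes \<iota> :: "('x::cbanach, 'y::cbanach) ctensor \<Rightarrow> 'z::cbanach"
  assumes "reasonable_uniform_crossnorm \<alpha>" and "is_completion \<alpha> \<iota>"
  shows "\<exists>!T. \<forall>x y. cblinfun_apply T (\<iota> (x \<otimes>\<^sub>C y)) =
                  \<iota> (cblinfun_apply A x \<otimes>\<^sub>C cblinfun_apply B y)"
proof -
  have lin: "Vector_Spaces.linear scaleC scaleC \<iota>"
    and iso: "norm (\<iota> u) = \<alpha> u" and dense: "closure (range \<iota>) = UNIV" for u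
    using assms(2) by (auto simp: is_completion_def)
  have add: "\<iota> (u + v) = \<iota> u + \<iota> v" and scale: "\<iota> (c *\<^sub>C u) = c *\<^sub>C \<iota> u" for u v c
    using Vector_Spaces.linear.axioms(3)[OF lin] by (simp_all add: module_hom_iff)
  have diff: "\<iota> (u - v) = \<iota> u - \<iota> v" for u v
    using add[of "u - v" v] by (simp add: algebra_simps)
  have zero: "\<iota> 0 = 0"
    using add[of 0 0] by simp
  have definite: "\<alpha> u = 0 \<Longrightarrow> u = 0"
    and uniform: "\<alpha> (ctensor_map A B u) \<le> norm A * norm B * \<alpha> u" for u
    using assms(1) by (auto simp: reasonable_uniform_crossnorm_def is_cnorm_def)
  define K where "K = norm A * norm B"
  have K: "0 \<le> K" by (simp add: K_def)
  have inj: "inj \<iota>"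
  proof (rule injI)
    fix u v assume "\<iota> u = \<iota> v"
    then have "\<alpha> (u - v) = 0" using diff iso by (metis diff_self norm_zero)
    then show "u = v" using definite by force
  qed
  have map_diff: "ctensor_map A B (u - v) = ctensor_map A B u - ctensor_map A B v" for u v
    using ctensor_map_add[of A B "u - v" v] by (simp add: algebra_simps)
  define f where "f = (\<lambda>z. \<iota> (ctensor_map A B (inv \<iota> z)))"
  have f: "f (\<iota> u) = \<iota> (ctensor_map A B u)" for u
    by (simp add: f_def inj)
  have lip: "dist (f z) (f w) \<le> K * dist z w" if zw: "z \<in> range \<iota>" "w \<in> range \<iota>" for z w
  proof -
    obtain u v where "z = \<iota> u" "w = \<iota> v" using zw by blast
    then show ?thesis
      using uniform[of "u - v"]
      by (simp add: f dist_norm diff[symmetric] map_diff[symmetric] iso K_def)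
  qed
  have "uniformly_continuous_on (range \<iota>) f"
    by (rule lipschitz_on_uniformly_continuous[of K]) (simp add: lipschitz_on_def K lip)
  then obtain g where g_cont: "uniformly_continuous_on UNIV g"
    and fg: "\<And>z. z \<in> range \<iota> \<Longrightarrow> f z = g z"
    by (rule uniformly_continuous_on_extension_on_closure) (use dense in auto)
  have g: "g (\<iota> u) = \<iota> (ctensor_map A B u)" for u
    using fg[of "\<iota> u"] f[of u] by simp
  have approx: "\<exists>s. (\<lambda>n::nat. \<iota> (s n)) \<longlonglongrightarrow> z" for z
  proof -
    have "z \<in> closure (range \<iota>)" using dense by simp
    then obtain t where t: "\<forall>n. t n \<in> range \<iota>" "t \<longlonglongrightarrow> z"
      unfolding closure_sequential by blast
    then have "\<exists>s. t = (\<lambda>n. \<iota> (s n))"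
      by (intro exI[of _ "\<lambda>n. inv \<iota> (t n)"]) (simp add: fun_eq_iff f_inv_into_f)
    with t(2) show ?thesis by blast
  qed
  have g_lim: "(\<lambda>n. g (t n)) \<longlonglongrightarrow> g z" if "t \<longlonglongrightarrow> z" for t :: "nat \<Rightarrow> 'z" and z
    by (rule continuous_on_tendsto_compose[OF uniformly_continuous_imp_continuous[OF g_cont] that])
      simp_all
  have g_add: "g (z + w) = g z + g w" for z w
  proof -
    obtain s t where st: "(\<lambda>n. \<iota> (s n)) \<longlonglongrightarrow> z" "(\<lambda>n. \<iota> (t n)) \<longlonglongrightarrow> w"
      using approx by metis
    have "(\<lambda>n. g (\<iota> (s n) + \<iota> (t n))) \<longlonglongrightarrow> g (z + w)"
      by (intro g_lim tendsto_add st)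
    moreover have "(\<lambda>n. g (\<iota> (s n) + \<iota> (t n))) = (\<lambda>n. g (\<iota> (s n)) + g (\<iota> (t n)))"
      by (simp add: add[symmetric] g ctensor_map_add)
    moreover have "(\<lambda>n. g (\<iota> (s n)) + g (\<iota> (t n))) \<longlonglongrightarrow> g z + g w"
      by (intro tendsto_add g_lim st)
    ultimately show ?thesis by (metis LIMSEQ_unique)
  qed
  have g_scale: "g (c *\<^sub>C z) = c *\<^sub>C g z" for c z
  proof -
    obtain s where s: "(\<lambda>n. \<iota> (s n)) \<longlonglongrightarrow> z"
      using approx by metis
    have "(\<lambda>n. g (c *\<^sub>C \<iota> (s n))) \<longlonglongrightarrow> g (c *\<^sub>C z)"
      by (intro g_lim bounded_linear.tendsto[OF bounded_linear_scaleC] s)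
    moreover have "(\<lambda>n. g (c *\<^sub>C \<iota> (s n))) = (\<lambda>n. c *\<^sub>C g (\<iota> (s n)))"
      by (simp add: scale[symmetric] g ctensor_map_scaleC)
    moreover have "(\<lambda>n. c *\<^sub>C g (\<iota> (s n))) \<longlonglongrightarrow> c *\<^sub>C g z"
      by (intro bounded_linear.tendsto[OF bounded_linear_scaleC] g_lim s)
    ultimately show ?thesis by (metis LIMSEQ_unique)
  qed
  have g_bound: "norm (g z) \<le> norm z * K" for z
  proof -
    obtain s where s: "(\<lambda>n. \<iota> (s n)) \<longlonglongrightarrow> z"
      using approx by metis
    show ?thesis
    proof (rule LIMSEQ_le)
      show "(\<lambda>n. norm (g (\<iota> (s n)))) \<longlonglongrightarrow> norm (g z)"
        by (intro tendsto_norm g_lim s)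
      show "(\<lambda>n. norm (\<iota> (s n)) * K) \<longlonglongrightarrow> norm z * K"
        by (intro tendsto_intros s)
      show "\<exists>N. \<forall>n\<ge>N. norm (g (\<iota> (s n))) \<le> norm (\<iota> (s n)) * K"
        using uniform by (auto simp: g iso K_def mult.commute)
    qed
  qed
  have "bounded_linear g"
    by (rule bounded_linear_intro[where K = K]) (simp_all add: g_add scaleR_scaleC g_scale g_bound)
  then obtain T where T: "cblinfun_apply T = g"
    using cblinfun_exI g_scale by blast
  show ?thesis
  proof (rule ex1I[of _ T])
    show "\<forall>x y. cblinfun_apply T (\<iota> (x \<otimes>\<^sub>C y)) = \<iota> (cblinfun_apply A x \<otimes>\<^sub>C cblinfun_apply B y)"
      by (simp add: T g ctensor_map_tensor)
  next
    fix S :: "('z, 'z) cblinfun"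
    assume S: "\<forall>x y. cblinfun_apply S (\<iota> (x \<otimes>\<^sub>C y)) =
        \<iota> (cblinfun_apply A x \<otimes>\<^sub>C cblinfun_apply B y)"
    interpret S: bounded_linear "cblinfun_apply S"
      by (rule bounded_linear_cblinfun_apply)
    interpret T: bounded_linear "cblinfun_apply T"
      by (rule bounded_linear_cblinfun_apply)
    have eq: "cblinfun_apply S (\<iota> u) = cblinfun_apply T (\<iota> u)" for u
    proof (induction u rule: ctensor_induct)
      case 1
      show ?case by (simp add: zero S.zero T.zero)
    next
      case (2 x y u)
      then show ?case
        using S by (simp add: add S.add T.add) (simp add: T g ctensor_map_tensor)
    qed
    show "S = T"
    proof (rule cblinfun_eqI)
      fix z
      obtain s where s: "(\<lambda>n. \<iota> (s n)) \<longlonglongrightarrow> z"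
        using approx by metis
      show "cblinfun_apply S z = cblinfun_apply T z"
        using S.tendsto[OF s] T.tendsto[OF s] eq by (simp add: LIMSEQ_unique)
    qed
  qed
qed

end

(*
  Write P for A \<otimes> I (or for left multiplication by A) and Q for I \<otimes> B (or for right multiplication
  by B): these are commuting operators with product T = A \<otimes> B (or T = \<tau>). Let z be in the spectrum
  but not in the B-Weyl spectrum of T. By hypothesis all spectral values m of A and n of B
  with m n = z are poles, hence a power of A - m and a power of B - n are group invertible and yield
  idempotents of the bicommutant of P and Q on which x = T - z is nilpotent. A character of the
  bicommutant that vanishes on x and on the annihilators of all powers of x would take the value 1
  on one of the products of these idempotents, which is absurd. So x and these annihilators generate
  the unit ideal, i.e. x ^ n = x ^ (n + 1) a with a commuting with x, and z is a pole of T.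
*)
theory Submission
  imports Defs
begin

section \<open>Gelfand-Mazur theorem for seminorms\<close>

text \<open>Group inverses enter because a pole need not be of order one: with finite ascent and
  descent, only a sufficiently high power of A - m is certain to split the space into its null space
  and its range. The idempotents are then obtained algebraically, and the character handles one pair
  (m, n) at a time, namely its own values at P and Q. The bicommutant suits this purpose because it
  is commutative and contains the inverses and the group inverses of its elements, so that the
  idempotents lie in the domain of the character. The ideal of x and the annihilators is purely
  algebraic, since an exact equation 1 = x r + c is wanted. A maximal ideal M above it comes from
  Zorn's lemma. The quotient by M is never formed: the distance to M is treated as a seminorm on the
  bicommutant, and Gelfand-Mazur is proved for such seminorms by following the growth of the powers
  a ^ (2 ^ m).\<close>

class cbanach_algebra = cbanach + real_normed_algebra + monoid_mult +
  assumes mult_scaleC_left: "(c *\<^sub>C x) * y = c *\<^sub>C (x * y)"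
    and mult_scaleC_right: "x * (c *\<^sub>C y) = c *\<^sub>C (x * y)"

text \<open>A right and a left inverse are the fixed points of the contractions z -> 1 + (1 - y) z
  and z -> 1 + z (1 - y); associativity makes them equal.\<close>

lemma near_one_invertible:
  fixes y :: "'a::cbanach_algebra"
  assumes "norm (1 - y) < 1"
  shows "\<exists>z. y * z = 1 \<and> z * y = 1"
proof -
  have "\<exists>!z. 1 + (1 - y) * z = z"
  proof (rule banach_fix_type[of "norm (1 - y)"])
    show "\<forall>u v. dist (1 + (1 - y) * u) (1 + (1 - y) * v) \<le> norm (1 - y) * dist u v"
    proof (intro allI)
      fix u v
      show "dist (1 + (1 - y) * u) (1 + (1 - y) * v) \<le> norm (1 - y) * dist u v"
        using norm_mult_ineq[of "1 - y" "u - v"] by (simp add: dist_norm right_diff_distrib)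
    qed
  qed (use assms in auto)
  then obtain z where "1 + (1 - y) * z = z" by blast
  then have z: "y * z = 1" by (simp add: left_diff_distrib)
  have "\<exists>!z. 1 + z * (1 - y) = z"
  proof (rule banach_fix_type[of "norm (1 - y)"])
    show "\<forall>u v. dist (1 + u * (1 - y)) (1 + v * (1 - y)) \<le> norm (1 - y) * dist u v"
    proof (intro allI)
      fix u v
      show "dist (1 + u * (1 - y)) (1 + v * (1 - y)) \<le> norm (1 - y) * dist u v"
        using norm_mult_ineq[of "u - v" "1 - y"]
        by (simp add: dist_norm left_diff_distrib mult.commute)
    qed
  qed (use assms in auto)
  then obtain z' where "1 + z' * (1 - y) = z'" by blast
  then have z': "z' * y = 1" by (simp add: right_diff_distrib)
  have "z' = z" using z z' by (metis mult.assoc mult_1_left mult_1_right)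
  with z z' show ?thesis by blast
qed

section \<open>Commutative subalgebras and submultiplicative seminorms\<close>

locale comm_subalgebra =
  fixes C :: "'a::cbanach_algebra set"
  assumes one: "1 \<in> C"
    and add: "x \<in> C \<Longrightarrow> y \<in> C \<Longrightarrow> x + y \<in> C"
    and scale: "x \<in> C \<Longrightarrow> c *\<^sub>C x \<in> C"
    and mult: "x \<in> C \<Longrightarrow> y \<in> C \<Longrightarrow> x * y \<in> C"
    and comm: "x \<in> C \<Longrightarrow> y \<in> C \<Longrightarrow> x * y = y * x"
begin

lemma uminus: "x \<in> C \<Longrightarrow> - x \<in> C"
  using scale[of x "-1"] by (simp add: complex_vector.scale_minus_left scaleC_one)

lemma diff: "x \<in> C \<Longrightarrow> y \<in> C \<Longrightarrow> x - y \<in> C"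
  using add[of x "- y"] uminus[of y] by simp

lemma power: "x \<in> C \<Longrightarrow> x ^ n \<in> C"
  by (induction n) (simp_all add: one mult)

lemma zero: "0 \<in> C"
  using diff[OF one one] by simp

lemmas closed = one zero add scale mult uminus diff power

lemma left_comm: "x \<in> C \<Longrightarrow> y \<in> C \<Longrightarrow> x * (y * z) = y * (x * z)"
  by (metis comm mult.assoc)

end

text \<open>Plays the part of a quotient norm: equality in the quotient is expressed as
  \<open>q (x - y) = 0\<close>. The laws are imposed on \<open>C\<close> only, because commutativity
  is what makes the distance to an ideal submultiplicative.\<close>

locale subalgebra_seminorm = comm_subalgebra C
  for C :: "'a::cbanach_algebra set" +
  fixes q :: "'a \<Rightarrow> real"
  assumes q_nonneg: "x \<in> C \<Longrightarrow> 0 \<le> q x"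
    and q_add: "x \<in> C \<Longrightarrow> y \<in> C \<Longrightarrow> q (x + y) \<le> q x + q y"
    and q_scale: "x \<in> C \<Longrightarrow> q (c *\<^sub>C x) = cmod c * q x"
    and q_mult: "x \<in> C \<Longrightarrow> y \<in> C \<Longrightarrow> q (x * y) \<le> q x * q y"
    and q_one: "q 1 \<noteq> 0"
begin

lemma q_minus: "x \<in> C \<Longrightarrow> q (- x) = q x"
  using q_scale[of x "-1"] by (simp add: complex_vector.scale_minus_left scaleC_one)

lemma q_diff: "x \<in> C \<Longrightarrow> y \<in> C \<Longrightarrow> q (x - y) \<le> q x + q y"
  using q_add[of x "- y"] q_minus[of y] uminus[of y] by simp

lemma q_power: "x \<in> C \<Longrightarrow> q (x ^ n) \<le> q x ^ n * q 1"
proof (induction n)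
  case (Suc n)
  then show ?case
    using q_mult[of x "x ^ n"] power[of x n] mult_left_mono[OF Suc.IH q_nonneg[of x]]
    by (simp add: mult.assoc)
qed simp

lemma q_null_mult: "x \<in> C \<Longrightarrow> y \<in> C \<Longrightarrow> q x = 0 \<Longrightarrow> q (y * x) = 0"
  using q_mult[of y x] q_nonneg[of "y * x"] mult[of y x] by simp

lemma q_null_add: "x \<in> C \<Longrightarrow> y \<in> C \<Longrightarrow> q x = 0 \<Longrightarrow> q y = 0 \<Longrightarrow> q (x + y) = 0"
  using q_add[of x y] q_nonneg[of "x + y"] add[of x y] by simp

lemma q_cong: "x \<in> C \<Longrightarrow> y \<in> C \<Longrightarrow> q (x - y) = 0 \<Longrightarrow> q x = q y"
  using q_add[of "x - y" y] q_diff[of x "x - y"] diff[of x y] by simp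

section \<open>Inverses modulo the null space of the seminorm\<close>

definition qinv :: "'a \<Rightarrow> 'a \<Rightarrow> bool" where
  "qinv u w \<longleftrightarrow> u \<in> C \<and> w \<in> C \<and> q (u * w - 1) = 0"

text \<open>The resolvent identity w - w' = w w' (u' - u), which holds up to multiples of the
  defects u w - 1 and u' w' - 1, both of seminorm 0.\<close>

lemma qinv_dist:
  assumes "qinv u w" and "qinv u' w'"
  shows "q (w - w') \<le> q w * q w' * q (u' - u)"
proof -
  have C: "u \<in> C" "w \<in> C" "u' \<in> C" "w' \<in> C"
    and null: "q (u * w - 1) = 0" "q (u' * w' - 1) = 0"
    using assms by (auto simp: qinv_def)
  have "w - w' - w * w' * (u' - u) = w' * (u * w - 1) + (- w) * (u' * w' - 1)"
    using C by (simp add: algebra_simps comm left_comm)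
  then have "q (w - w' - w * w' * (u' - u)) = 0"
    using C null by (simp only:) (intro q_null_add q_null_mult closed)
  then have "q (w - w') = q (w * w' * (u' - u))"
    using C by (intro q_cong closed)
  also have "\<dots> \<le> q (w * w') * q (u' - u)"
    using C by (intro q_mult closed)
  also have "\<dots> \<le> q w * q w' * q (u' - u)"
    using C by (intro mult_right_mono q_mult q_nonneg closed)
  finally show ?thesis .
qed

lemma qinv_unique:
  assumes "qinv u w" and "qinv u w'"
  shows "q (w - w') = 0"
proof -
  have C: "u \<in> C" "w \<in> C" "w' \<in> C" using assms by (auto simp: qinv_def)
  have "q (0 :: 'a) = 0" using q_scale[OF one, of 0] by simp
  then show ?thesis
    using qinv_dist[OF assms] q_nonneg[of "w - w'"] C by (simp add: closed)
qed

text \<open>Partial fractions: 1 / (1 - y y) is the mean of 1 / (1 - y) and 1 / (1 + y).\<close>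

lemma qinv_square:
  assumes "qinv (1 - y) w" and "qinv (1 + y) w'" and "y \<in> C"
  shows "qinv (1 - y * y) ((1 / 2) *\<^sub>C (w + w'))"
proof -
  have C: "w \<in> C" "w' \<in> C" and null: "q ((1 - y) * w - 1) = 0" "q ((1 + y) * w' - 1) = 0"
    using assms by (auto simp: qinv_def)
  have half: "(1 / 2) *\<^sub>C (1 + 1) = (1 :: 'a)"
    by (simp add: scaleC_add_right scaleC_add_left[symmetric] scaleC_one)
  have "(1 - y * y) * ((1 / 2) *\<^sub>C (w + w')) - 1 = (1 / 2) *\<^sub>C ((1 - y * y) * (w + w') - (1 + 1))"
    by (simp add: mult_scaleC_right complex_vector.scale_right_diff_distrib half)
  also have "(1 - y * y) * (w + w') - (1 + 1)
      = (1 + y) * ((1 - y) * w - 1) + (1 - y) * ((1 + y) * w' - 1)"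
    by (simp add: algebra_simps)
  finally have "q ((1 - y * y) * ((1 / 2) *\<^sub>C (w + w')) - 1) = 0"
    using C null assms(3) by (simp only: q_scale closed) (simp add: q_null_add q_null_mult closed)
  then show ?thesis
    using C assms(3) by (simp add: qinv_def closed)
qed

text \<open>The resolvent identity bounds the resolvent near each point, and compactness of the disc
  makes the bound uniform. It covers every choice of the inverse \<open>w\<close>.\<close>

lemma qinv_bounded:
  assumes a: "a \<in> C" and ex: "\<And>\<nu>. \<exists>w. qinv (1 - \<nu> *\<^sub>C a) w"
  obtains S where "0 < S" and "\<And>\<nu> w. cmod \<nu> \<le> \<rho> \<Longrightarrow> qinv (1 - \<nu> *\<^sub>C a) w \<Longrightarrow> q w \<le> S"
proof -
  obtain R where R: "\<And>\<nu>. qinv (1 - \<nu> *\<^sub>C a) (R \<nu>)" using ex by metis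
  have RC: "R \<nu> \<in> C" for \<nu> using R by (simp add: qinv_def)
  \<comment> \<open>The radius makes \<open>cmod (\<mu> - \<nu>) * (q a * q (R \<nu>))\<close> at
    most 1 / 2, so that the term \<open>q w / 2\<close> in the estimate can be absorbed on the left;
    the summand 1 keeps the denominator positive.\<close>
  define d where "d \<nu> = 1 / (2 * (q a * q (R \<nu>) + 1))" for \<nu>
  have pos: "0 < q a * q (R \<nu>) + 1" for \<nu>
    using q_nonneg[OF a] q_nonneg[OF RC] by (simp add: add_nonneg_pos)
  then have d: "0 < d \<nu>" for \<nu>
    unfolding d_def by (intro divide_pos_pos mult_pos_pos) auto
  have loc: "q w \<le> 2 * q (R \<nu>)" if "\<mu> \<in> ball \<nu> (d \<nu>)" "qinv (1 - \<mu> *\<^sub>C a) w" for \<mu> \<nu> w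
  proof -
    have w: "w \<in> C" using that by (simp add: qinv_def)
    have "q (w - R \<nu>) \<le> q w * q (R \<nu>) * q (1 - \<nu> *\<^sub>C a - (1 - \<mu> *\<^sub>C a))"
      by (rule qinv_dist[OF that(2) R])
    also have "1 - \<nu> *\<^sub>C a - (1 - \<mu> *\<^sub>C a) = (\<mu> - \<nu>) *\<^sub>C a"
      by (simp add: complex_vector.scale_left_diff_distrib)
    also have "q w * q (R \<nu>) * q \<dots> = q w * (cmod (\<mu> - \<nu>) * (q a * q (R \<nu>)))"
      using a by (simp add: q_scale)
    also have "\<dots> \<le> q w * (1 / 2)"
    proof (rule mult_left_mono)
      have "cmod (\<mu> - \<nu>) * (q a * q (R \<nu>)) \<le> d \<nu> * (q a * q (R \<nu>) + 1)"
        using that(1) q_nonneg[OF a] q_nonneg[OF RC[of \<nu>]] d[of \<nu>]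
        by (intro mult_mono) (auto simp: dist_norm norm_minus_commute)
      also have "\<dots> = 1 / 2" using pos[of \<nu>] by (simp add: d_def)
      finally show "cmod (\<mu> - \<nu>) * (q a * q (R \<nu>)) \<le> 1 / 2" .
    qed (rule q_nonneg[OF w])
    finally have "q (w - R \<nu>) \<le> q w / 2" by simp
    moreover have "q w \<le> q (w - R \<nu>) + q (R \<nu>)"
      using q_add[of "w - R \<nu>" "R \<nu>"] w RC diff by simp
    ultimately show ?thesis by simp
  qed
  obtain D where D: "D \<subseteq> cball 0 \<rho>" "finite D" "cball 0 \<rho> \<subseteq> (\<Union>\<nu>\<in>D. ball \<nu> (d \<nu>))"
    by (rule compactE_image[OF compact_cball, of "cball 0 \<rho>" "\<lambda>\<nu>. ball \<nu> (d \<nu>)" 0 \<rho>])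
      (use d in auto)
  show ?thesis
  proof
    \<comment> \<open>The summand 1 gives a positive bound even if \<open>D\<close> is empty, as
      happens for negative \<rho>.\<close>
    show "0 < 1 + (\<Sum>\<nu>\<in>D. 2 * q (R \<nu>))"
      by (intro add_pos_nonneg sum_nonneg mult_nonneg_nonneg q_nonneg RC) simp_all
    fix \<mu> w assume "cmod \<mu> \<le> \<rho>" and w: "qinv (1 - \<mu> *\<^sub>C a) w"
    then have "\<mu> \<in> cball 0 \<rho>" by simp
    then obtain \<nu> where \<nu>: "\<nu> \<in> D" "\<mu> \<in> ball \<nu> (d \<nu>)" using D(3) by blast
    have "q w \<le> 2 * q (R \<nu>)" by (rule loc[OF \<nu>(2) w])
    also have "\<dots> \<le> (\<Sum>\<nu>\<in>D. 2 * q (R \<nu>))"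
      by (rule member_le_sum[OF \<nu>(1)]) (simp_all add: q_nonneg RC D(2))
    finally show "q w \<le> 1 + (\<Sum>\<nu>\<in>D. 2 * q (R \<nu>))" by simp
  qed
qed

section \<open>Resolvents of the powers a ^ (2 ^ m)\<close>

lemma power_double: "(x :: 'a) ^ (2 ^ Suc m) = x ^ (2 ^ m) * x ^ (2 ^ m)"
  by (simp add: mult_2 power_add)

lemma scale_square:
  "(\<kappa> ^ 2) *\<^sub>C ((x :: 'a) ^ (2 ^ Suc m)) = (\<kappa> *\<^sub>C x ^ (2 ^ m)) * (\<kappa> *\<^sub>C x ^ (2 ^ m))"
  by (simp only: power_double mult_scaleC_left mult_scaleC_right scaleC_scaleC power2_eq_square)

lemma qinv_double:
  assumes a: "a \<in> C" and "qinv (1 - \<kappa> *\<^sub>C a ^ (2 ^ m)) w" and "qinv (1 - (- \<kappa>) *\<^sub>C a ^ (2 ^ m)) w'"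
  shows "qinv (1 - (\<kappa> ^ 2) *\<^sub>C a ^ (2 ^ Suc m)) ((1 / 2) *\<^sub>C (w + w'))"
  unfolding scale_square
  by (rule qinv_square) (use assms in \<open>simp_all add: complex_vector.scale_minus_left closed\<close>)

text \<open>Every complex number is a square, so the averaging step can be iterated from each power
  to its square.\<close>

lemma qinv_power_exists:
  assumes a: "a \<in> C" and ex: "\<And>\<nu>. \<exists>w. qinv (1 - \<nu> *\<^sub>C a) w"
  shows "\<exists>w. qinv (1 - \<nu> *\<^sub>C a ^ (2 ^ m)) w"
proof (induction m arbitrary: \<nu>)
  case 0
  then show ?case using ex by simp
next
  case (Suc m)
  have "\<nu> = (csqrt \<nu>)\<^sup>2" by simp
  then show ?case using qinv_double[OF a] Suc by metis
qed

text \<open>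
  Averaging over \<open>\<plusminus>\<kappa>\<close> turns inverses of \<open>1 - \<kappa> y\<close> into inverses of \<open>1 - \<kappa>\<^sup>2 y\<^sup>2\<close>; hence a modulus
  of continuity of the resolvent of \<open>a\<close> along a radius is inherited by all powers \<open>a ^ (2 ^ m)\<close>.
  This is what lets the decay of \<open>r ^ n * q (a ^ n)\<close>, \<open>n = 2 ^ m\<close>, propagate to ever larger radii \<open>r\<close>.
\<close>

lemma qinv_power_dist:
  assumes a: "a \<in> C" and ex: "\<And>\<nu>. \<exists>w. qinv (1 - \<nu> *\<^sub>C a) w" and "0 \<le> r"
    and base: "\<And>\<nu> w w'. cmod \<nu> = r \<Longrightarrow> qinv (1 - \<nu> *\<^sub>C a) w \<Longrightarrow>
      qinv (1 - (complex_of_real t * \<nu>) *\<^sub>C a) w' \<Longrightarrow> q (w - w') \<le> \<epsilon>"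
  shows "cmod \<nu> = r ^ (2 ^ m) \<Longrightarrow> qinv (1 - \<nu> *\<^sub>C a ^ (2 ^ m)) w \<Longrightarrow>
      qinv (1 - (complex_of_real t ^ (2 ^ m) * \<nu>) *\<^sub>C a ^ (2 ^ m)) w' \<Longrightarrow> q (w - w') \<le> \<epsilon>"
proof (induction m arbitrary: \<nu> w w')
  case 0
  then show ?case using base by simp
next
  case (Suc m)
  define \<kappa> where "\<kappa> = csqrt \<nu>"
  define \<tau> where "\<tau> = complex_of_real t ^ (2 ^ m)"
  have \<nu>: "\<nu> = \<kappa>\<^sup>2" by (simp add: \<kappa>_def)
  have \<tau>\<nu>: "complex_of_real t ^ (2 ^ Suc m) * \<nu> = (\<tau> * \<kappa>)\<^sup>2"
    by (simp add: \<nu> \<tau>_def power_mult_distrib power_mult[symmetric] mult.commute)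
  have "(cmod \<kappa>)\<^sup>2 = (r ^ (2 ^ m))\<^sup>2"
    using Suc.prems(1) by (simp add: \<nu> norm_power power_mult[symmetric] mult.commute)
  then have \<kappa>: "cmod \<kappa> = r ^ (2 ^ m)"
    using \<open>0 \<le> r\<close> by (simp add: power2_eq_iff_nonneg)
  obtain u v where u: "qinv (1 - \<kappa> *\<^sub>C a ^ (2 ^ m)) u" and v: "qinv (1 - (- \<kappa>) *\<^sub>C a ^ (2 ^ m)) v"
    using qinv_power_exists[OF a ex] by meson
  obtain u' v' where u': "qinv (1 - (\<tau> * \<kappa>) *\<^sub>C a ^ (2 ^ m)) u'"
    and v': "qinv (1 - (- (\<tau> * \<kappa>)) *\<^sub>C a ^ (2 ^ m)) v'"
    using qinv_power_exists[OF a ex] by meson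
  have C: "u \<in> C" "v \<in> C" "u' \<in> C" "v' \<in> C" "w \<in> C" "w' \<in> C"
    using u v u' v' Suc.prems by (auto simp: qinv_def)
  \<comment> \<open>Inverses are unique only up to null vectors of \<open>q\<close>; hence
    \<open>w\<close> and \<open>w'\<close> are replaced by averages over the two square roots before
    the induction hypothesis is applied to each root.\<close>
  have "q (w - (1 / 2) *\<^sub>C (u + v)) = 0"
    using qinv_unique[OF Suc.prems(2)] qinv_double[OF a u v] \<nu> by simp
  then have 1: "q ((w - w') - ((1 / 2) *\<^sub>C (u + v) - w')) = 0" by simp
  have "q ((1 / 2) *\<^sub>C (u' + v') - w') = 0"
    using qinv_unique[OF qinv_double[OF a u' v']] Suc.prems(3) \<tau>\<nu> by simp
  then have "q (((1 / 2) *\<^sub>C (u + v) - w') - ((1 / 2) *\<^sub>C (u + v) - (1 / 2) *\<^sub>C (u' + v'))) = 0"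
    by simp
  with 1 C have "q (w - w') = q ((1 / 2) *\<^sub>C (u + v) - (1 / 2) *\<^sub>C (u' + v'))"
    using q_cong closed by (metis (no_types, lifting))
  also have "(1 / 2) *\<^sub>C (u + v) - (1 / 2) *\<^sub>C (u' + v') = (1 / 2) *\<^sub>C ((u - u') + (v - v'))"
    by (simp add: complex_vector.scale_right_diff_distrib[symmetric] algebra_simps)
  also have "q \<dots> \<le> 1 / 2 * (q (u - u') + q (v - v'))"
    using q_add[of "u - u'" "v - v'"] C by (simp add: q_scale closed)
  also have "\<dots> \<le> 1 / 2 * (\<epsilon> + \<epsilon>)"
  proof -
    have "q (u - u') \<le> \<epsilon>"
      using Suc.IH[OF \<kappa> u] u' by (simp add: \<tau>_def)
    moreover have "q (v - v') \<le> \<epsilon>"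
      using Suc.IH[of "- \<kappa>" v v'] \<kappa> v v' by (simp add: \<tau>_def)
    ultimately show ?thesis by simp
  qed
  finally show ?case by simp
qed

text \<open>Put n = 2 ^ m and y = a ^ n. At the radius s < r the quantity s ^ n * q y tends to 0, so
  the resolvent of y at s ^ n is close to 1. By \<open>qinv_power_dist\<close> the resolvent at r' ^
  n is within 1 / 4 of it for every m, hence within 1 / 2 of 1, and this forces r' ^ n * q y \<le>
  1. The admissible gain in radius depends only on \<open>q a\<close> and \<open>S\<close>, not on
  m.\<close>

lemma power_small_step:
  assumes a: "a \<in> C" and ex: "\<And>\<nu>. \<exists>w. qinv (1 - \<nu> *\<^sub>C a) w"
    and S: "0 < S" "\<And>\<nu> w. cmod \<nu> \<le> \<rho> \<Longrightarrow> qinv (1 - \<nu> *\<^sub>C a) w \<Longrightarrow> q w \<le> S"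
    and r: "0 \<le> s" "s < r" "r < r'" "r' \<le> \<rho>" and small: "(r' - s) * (q a * S\<^sup>2) \<le> 1 / 4"
    and good: "\<forall>\<^sub>F m in sequentially. r ^ (2 ^ m) * q (a ^ (2 ^ m)) \<le> 1"
  shows "\<forall>\<^sub>F m in sequentially. r' ^ (2 ^ m) * q (a ^ (2 ^ m)) \<le> 1"
proof -
  \<comment> \<open>Scaling by \<open>t\<close> maps the circle of radius \<open>r'\<close> onto the
    one of radius \<open>s\<close>, and its powers do the same for the powers of the two
    radii.\<close>
  define t where "t = s / r'"
  have t: "0 \<le> t" "t * r' = s" using r by (auto simp: t_def)
  have base: "q (w - w') \<le> 1 / 4"
    if "cmod \<nu> = r'" "qinv (1 - \<nu> *\<^sub>C a) w" "qinv (1 - (complex_of_real t * \<nu>) *\<^sub>C a) w'"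
    for \<nu> w w'
  proof -
    have wC: "w \<in> C" "w' \<in> C" using that by (auto simp: qinv_def)
    have "cmod (complex_of_real t * \<nu>) = s" using that(1) t by (simp add: norm_mult)
    then have w: "q w \<le> S" "q w' \<le> S"
      using S(2)[OF _ that(2)] S(2)[OF _ that(3)] that(1) r by simp_all
    have "q (w - w') \<le> q w * q w' * q (1 - (complex_of_real t * \<nu>) *\<^sub>C a - (1 - \<nu> *\<^sub>C a))"
      by (rule qinv_dist[OF that(2,3)])
    also have "1 - (complex_of_real t * \<nu>) *\<^sub>C a - (1 - \<nu> *\<^sub>C a) = ((1 - complex_of_real t) * \<nu>) *\<^sub>C a"
      by (simp add: complex_vector.scale_left_diff_distrib algebra_simps)
    also have "q \<dots> = (r' - s) * q a"
    proof -
      have "t \<le> 1" using r by (simp add: t_def)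
      then have "cmod (1 - complex_of_real t) = 1 - t"
        by (metis abs_of_nonneg diff_ge_0_iff_ge norm_of_real of_real_1 of_real_diff)
      then have "cmod ((1 - complex_of_real t) * \<nu>) = r' - s"
        unfolding norm_mult using that(1) t by (simp add: left_diff_distrib)
      then show ?thesis using a by (simp only: q_scale)
    qed
    also have "q w * q w' * ((r' - s) * q a) \<le> S * S * ((r' - s) * q a)"
      using w wC q_nonneg S(1) r a by (intro mult_right_mono mult_mono) auto
    also have "\<dots> \<le> 1 / 4" using small by (simp add: power2_eq_square mult_ac)
    finally show ?thesis .
  qed
  have q1: "0 < q 1" using q_nonneg[OF one] q_one by simp
  \<comment> \<open>Chosen so that \<open>\<eta> * (q (w' - 1) + q 1)\<close> is at most
    \<open>q (w' - 1) / 2 + 1 / 8\<close>, whence \<open>q (w' - 1) \<le> 1 / 4\<close>.\<close>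
  define \<eta> where "\<eta> = min (1 / 2) (1 / (8 * q 1))"
  have \<eta>: "0 < \<eta>" "\<eta> \<le> 1 / 2" "\<eta> * q 1 \<le> 1 / 8"
    using q1 by (auto simp: \<eta>_def min_def field_simps)
  have lim: "(\<lambda>m. (s / r) ^ (2 ^ m)) \<longlonglongrightarrow> 0"
  proof -
    have "strict_mono (\<lambda>m::nat. (2::nat) ^ m)" by (simp add: strict_mono_def)
    then show ?thesis
      using LIMSEQ_subseq_LIMSEQ[OF LIMSEQ_power_zero[of "s / r"]] r by (auto simp: o_def)
  qed
  have "\<forall>\<^sub>F m in sequentially. (s / r) ^ (2 ^ m) < \<eta>"
    using order_tendstoD(2)[OF lim \<eta>(1)] .
  with good show ?thesis
  proof eventually_elim
    case (elim m)
    define y where "y = a ^ (2 ^ m)"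
    have y: "y \<in> C" using a by (simp add: y_def closed)
    have "s ^ (2 ^ m) * q y = (s / r) ^ (2 ^ m) * (r ^ (2 ^ m) * q y)"
      using r by (simp add: power_divide)
    also have "\<dots> \<le> \<eta> * 1"
      using elim r q_nonneg[OF y] by (intro mult_mono) (auto simp: y_def \<eta>(1) less_imp_le)
    finally have sy: "s ^ (2 ^ m) * q y \<le> \<eta>" by simp
    let ?\<nu> = "complex_of_real (r' ^ (2 ^ m))" and ?\<mu> = "complex_of_real (s ^ (2 ^ m))"
    obtain w where w: "qinv (1 - ?\<nu> *\<^sub>C y) w"
      using qinv_power_exists[OF a ex] y_def by metis
    obtain w' where w': "qinv (1 - ?\<mu> *\<^sub>C y) w'"
      using qinv_power_exists[OF a ex] y_def by metis
    have C: "w \<in> C" "w' \<in> C" using w w' by (auto simp: qinv_def)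
    have \<mu>: "?\<mu> = complex_of_real t ^ (2 ^ m) * ?\<nu>"
      using t by (simp add: power_mult_distrib[symmetric] del: of_real_power flip: of_real_mult of_real_power)
    have "q (w - w') \<le> 1 / 4"
    proof (rule qinv_power_dist[OF a ex _ base])
      show "cmod ?\<nu> = r' ^ (2 ^ m)" using r by (simp add: norm_power)
    qed (use w w' r \<mu> y_def in auto)
    moreover have "q (w' - 1) \<le> 1 / 4"
    proof -
      have "w' - 1 - (?\<mu> *\<^sub>C y) * w' = (1 - ?\<mu> *\<^sub>C y) * w' - 1"
        by (simp add: left_diff_distrib)
      then have "q (w' - 1 - (?\<mu> *\<^sub>C y) * w') = 0"
        using w' by (simp only: qinv_def)
      then have "q (w' - 1) = q ((?\<mu> *\<^sub>C y) * w')"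
        using C y by (intro q_cong closed)
      also have "\<dots> \<le> s ^ (2 ^ m) * q y * q w'"
        using q_mult[of "?\<mu> *\<^sub>C y" w'] C y r by (simp add: closed q_scale norm_power)
      also have "\<dots> \<le> \<eta> * (q (w' - 1) + q 1)"
        using sy q_add[of "w' - 1" 1] C q_nonneg \<eta> by (intro mult_mono) (auto simp: closed)
      also have "\<dots> \<le> q (w' - 1) / 2 + 1 / 8"
        using mult_right_mono[OF \<eta>(2) q_nonneg[of "w' - 1"]] C \<eta>(3) by (simp add: closed distrib_left)
      finally show ?thesis by simp
    qed
    ultimately have d: "q (w - 1) \<le> 1 / 2"
      using q_add[of "w - w'" "w' - 1"] C by (simp add: closed)
    let ?y = "?\<nu> *\<^sub>C y"
    have yC: "?y \<in> C" using y by (simp add: closed)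
    \<comment> \<open>Modulo null vectors \<open>?y * w\<close> equals \<open>w - 1\<close>, which
      leads to \<open>q ?y \<le> 1 / 2 + q ?y / 2\<close>.\<close>
    have "?y * w - (w - 1) = - ((1 - ?y) * w - 1)"
      by (simp add: left_diff_distrib)
    then have "q (?y * w - (w - 1)) = 0"
      using w C yC by (simp only: qinv_def q_minus closed)
    then have "q (?y * w) = q (w - 1)"
      using C y by (intro q_cong closed)
    moreover have "q ?y \<le> q (?y * w) + q (?y * (w - 1))"
      using q_diff[of "?y * w" "?y * (w - 1)"] C yC by (simp add: closed right_diff_distrib)
    moreover have "q (?y * (w - 1)) \<le> q ?y * (1 / 2)"
      using q_mult[of ?y "w - 1"] mult_left_mono[OF d q_nonneg[OF yC]] C yC by (simp add: closed)
    ultimately have "q ?y \<le> 1" using d by simp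
    then show ?case using y r by (simp add: q_scale norm_power y_def)
  qed
qed

text \<open>If every c - \<mu> were invertible, the inverse a of c would have a resolvent 1 / (1 -
  \<nu> a) at every \<nu>. Repeated small steps then give \<rho> ^ n * q (a ^ n) \<le> 1 for large n
  = 2 ^ m at a radius \<rho> > q c. This contradicts c ^ n * a ^ n = 1, which keeps q c ^ n * q (a ^
  n) at least 1.\<close>

theorem gelfand_mazur:
  assumes c: "c \<in> C"
  shows "\<exists>\<mu>. \<nexists>r. qinv (c - \<mu> *\<^sub>C 1) r"
proof (rule ccontr)
  assume "\<not> ?thesis"
  then have inv: "\<exists>r. qinv (c - \<mu> *\<^sub>C 1) r" for \<mu> by blast
  obtain a where "qinv (c - 0 *\<^sub>C 1) a" using inv by blast
  then have a: "a \<in> C" and ca: "q (c * a - 1) = 0" by (auto simp: qinv_def)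
  have ex: "\<exists>w. qinv (1 - \<nu> *\<^sub>C a) w" for \<nu>
  proof -
    obtain r where r: "r \<in> C" "q ((c - \<nu> *\<^sub>C 1) * r - 1) = 0"
      using inv[of \<nu>] by (auto simp: qinv_def)
    \<comment> \<open>In the quotient 1 - \<nu> a = a (c - \<nu>), whose inverse is c r.\<close>
    have "(1 - \<nu> *\<^sub>C a) * (c * r) - 1
        = ((c - \<nu> *\<^sub>C 1) * r - 1) + (- (\<nu> *\<^sub>C r)) * (c * a - 1)"
      using a c r by (simp add: algebra_simps mult_scaleC_left mult_scaleC_right comm left_comm)
    then have "q ((1 - \<nu> *\<^sub>C a) * (c * r) - 1) = 0"
      using a c r ca by (simp only:) (intro q_null_add q_null_mult closed)
    then have "qinv (1 - \<nu> *\<^sub>C a) (c * r)"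
      using a c r by (simp add: qinv_def closed)
    then show ?thesis ..
  qed
  \<comment> \<open>At this starting radius submultiplicativity alone controls all the
    powers.\<close>
  define r1 where "r1 = 1 / (q a + 1)"
  have qa: "0 \<le> q a" and qc: "0 \<le> q c" using a c q_nonneg by auto
  have r1: "0 < r1" "r1 * q a \<le> 1" using qa by (auto simp: r1_def field_simps)
  \<comment> \<open>The target must exceed \<open>q c\<close>; this one lies \<open>q c + 1\<close>
    above \<open>r1\<close>, a distance that is cut into \<open>K\<close> steps of length
    \<gamma>.\<close>
  define \<rho> where "\<rho> = r1 + q c + 1"
  obtain S where S: "0 < S" "\<And>\<nu> w. cmod \<nu> \<le> \<rho> \<Longrightarrow> qinv (1 - \<nu> *\<^sub>C a) w \<Longrightarrow> q w \<le> S"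
    using qinv_bounded[OF a ex, of \<rho>] by blast
  have q1: "0 < q 1" using q_nonneg[OF one] q_one by simp
  \<comment> \<open>A step from the radius r uses r - \<gamma> and r + \<gamma>, so the bound 1 / 4
    concerns \<open>2 * \<gamma> * (q a * S\<^sup>2)\<close>; \<gamma> \<le> r1 / 2 keeps the lower
    radius nonnegative already at the start. One \<open>S\<close> serves all steps because it bounds
    the resolvent on the whole disc of radius \<rho>.\<close>
  define \<delta> where "\<delta> = min (r1 / 2) (1 / (8 * (q a * S\<^sup>2 + 1)))"
  have den: "0 < q a * S\<^sup>2 + 1" using qa by (simp add: add_nonneg_pos)
  have \<delta>: "0 < \<delta>" "\<delta> \<le> r1 / 2" using r1 den by (auto simp: \<delta>_def)
  have \<delta>': "2 * \<delta> * (q a * S\<^sup>2) \<le> 1 / 4"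
  proof -
    have "2 * \<delta> * (q a * S\<^sup>2) \<le> 2 * (1 / (8 * (q a * S\<^sup>2 + 1))) * (q a * S\<^sup>2 + 1)"
      using \<delta>(1) qa by (intro mult_mono) (auto simp: \<delta>_def)
    also have "\<dots> = 1 / 4" using den by simp
    finally show ?thesis .
  qed
  obtain K :: nat where K: "(q c + 1) / \<delta> < K" using reals_Archimedean2 by blast
  have Kpos: "0 < K"
    using K \<delta>(1) qc
    by (metis divide_nonneg_pos add_nonneg_pos le_less_trans of_nat_0_less_iff zero_less_one order.strict_iff_not)
  define \<gamma> where "\<gamma> = (q c + 1) / K"
  have \<gamma>: "0 < \<gamma>" "\<gamma> \<le> \<delta>"
    using K Kpos \<delta>(1) qc by (auto simp: \<gamma>_def field_simps)
  have good: "\<forall>\<^sub>F m in sequentially. (r1 + k * \<gamma>) ^ (2 ^ m) * q (a ^ (2 ^ m)) \<le> 1" if "k \<le> K" for k :: nat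
    using that
  proof (induction k)
    case 0
    have "(r1 * q a) ^ (2 ^ m) \<le> 1" for m :: nat
      using r1 qa by (intro power_le_one) auto
    moreover have "q (a ^ n) \<le> q a ^ n" if "0 < n" for n :: nat
      using that
    proof (induction n rule: nat_induct_non_zero)
      case (Suc n)
      then show ?case
        using q_mult[OF a power[OF a, of n]] mult_left_mono[OF Suc.IH qa] by simp
    qed simp
    then have "r1 ^ n * q (a ^ n) \<le> (r1 * q a) ^ n" if "0 < n" for n :: nat
      using that r1 by (simp add: power_mult_distrib mult_left_mono)
    ultimately have "r1 ^ (2 ^ m) * q (a ^ (2 ^ m)) \<le> 1" for m :: nat
      by (meson order_trans zero_less_numeral zero_less_power)
    then show ?case by simp
  next
    case (Suc k)
    show ?case
    proof (rule power_small_step[OF a ex S])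
      show "\<forall>\<^sub>F m in sequentially. (r1 + k * \<gamma>) ^ (2 ^ m) * q (a ^ (2 ^ m)) \<le> 1"
        using Suc by simp
      have "0 \<le> real k * \<gamma>" using \<gamma>(1) by simp
      then show "0 \<le> r1 + real k * \<gamma> - \<gamma>" using \<delta>(2) \<gamma>(2) r1(1) by linarith
      have "real (Suc k) * \<gamma> \<le> real K * \<gamma>" using Suc.prems \<gamma>(1) by (intro mult_right_mono) auto
      also have "\<dots> = q c + 1" using Kpos by (simp add: \<gamma>_def)
      finally show "r1 + real (Suc k) * \<gamma> \<le> \<rho>" by (simp add: \<rho>_def)
      have "2 * \<gamma> * (q a * S\<^sup>2) \<le> 2 * \<delta> * (q a * S\<^sup>2)"
        using \<gamma> qa by (intro mult_right_mono) auto
      then show "(r1 + real (Suc k) * \<gamma> - (r1 + real k * \<gamma> - \<gamma>)) * (q a * S\<^sup>2) \<le> 1 / 4"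
        using \<delta>' by (simp add: algebra_simps)
    qed (use \<gamma> in \<open>simp_all add: algebra_simps\<close>)
  qed
  have "r1 + K * \<gamma> = \<rho>" using Kpos by (simp add: \<gamma>_def \<rho>_def)
  with good[of K] have good: "\<forall>\<^sub>F m in sequentially. \<rho> ^ (2 ^ m) * q (a ^ (2 ^ m)) \<le> 1" by simp
  have \<rho>: "q c < \<rho>" using r1 by (simp add: \<rho>_def)
  have lim: "(\<lambda>m. (q c / \<rho>) ^ (2 ^ m)) \<longlonglongrightarrow> 0"
  proof -
    have "strict_mono (\<lambda>m::nat. (2::nat) ^ m)" by (simp add: strict_mono_def)
    then show ?thesis
      using LIMSEQ_subseq_LIMSEQ[OF LIMSEQ_power_zero[of "q c / \<rho>"]] \<rho> qc by (auto simp: o_def)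
  qed
  have one_le: "q 1 \<le> q c ^ n * q 1 * q (a ^ n)" for n
  proof -
    have "q (c ^ n * a ^ n - 1) = 0"
    proof (induction n)
      case 0
      then show ?case using q_scale[OF one, of 0] by simp
    next
      case (Suc n)
      have "c ^ Suc n * a ^ Suc n - 1 = (c ^ n * a ^ n - 1) + (c ^ n * a ^ n) * (c * a - 1)"
        using a c by (simp add: algebra_simps comm left_comm closed)
      then show ?case
        using a c ca Suc by (simp only:) (intro q_null_add q_null_mult closed)
    qed
    then have "q 1 = q (c ^ n * a ^ n)"
      using q_cong[of "c ^ n * a ^ n" 1] a c by (simp add: closed)
    also have "\<dots> \<le> q (c ^ n) * q (a ^ n)" using a c by (intro q_mult closed)
    also have "\<dots> \<le> (q c ^ n * q 1) * q (a ^ n)"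
      using a c by (intro mult_right_mono q_power q_nonneg closed)
    finally show ?thesis .
  qed
  have "\<forall>\<^sub>F m in sequentially. (q c / \<rho>) ^ (2 ^ m) < 1"
    using order_tendstoD(2)[OF lim] by simp
  with good have "\<forall>\<^sub>F m in sequentially. False"
  proof eventually_elim
    case (elim m)
    let ?n = "2 ^ m :: nat"
    have "q c ^ ?n * q (a ^ ?n) = (q c / \<rho>) ^ ?n * (\<rho> ^ ?n * q (a ^ ?n))"
      using \<rho> qc by (simp add: power_divide)
    also have "\<dots> \<le> (q c / \<rho>) ^ ?n * 1"
      using elim \<rho> qc by (intro mult_left_mono) auto
    also have "\<dots> < 1" using elim by simp
    finally have "q c ^ ?n * q (a ^ ?n) * q 1 < 1 * q 1"
      using q1 by (intro mult_strict_right_mono)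
    then show ?case using one_le[of ?n] by (simp add: mult_ac)
  qed
  then show False by simp
qed

end

section \<open>Products of commuting elements of a Banach algebra\<close>

text \<open>The distance need not be attained; with a minimising sequence, inequalities for norms
  pass to distances in the limit.\<close>

lemma infdist_sequence:
  fixes x :: "'a::real_normed_vector"
  assumes "M \<noteq> {}"
  obtains m where "\<And>n. m n \<in> M" and "(\<lambda>n::nat. norm (x - m n)) \<longlonglongrightarrow> infdist x M"
proof -
  have "\<exists>y\<in>M. dist x y < infdist x M + inverse (real (Suc n))" for n
    using assms cInf_lessD[of "dist x ` M" "infdist x M + inverse (real (Suc n))"]
    by (auto simp: infdist_def image_def)
  then obtain m where m: "\<And>n. m n \<in> M" "\<And>n. dist x (m n) < infdist x M + inverse (real (Suc n))"
    by metis
  have "(\<lambda>n. norm (x - m n)) \<longlonglongrightarrow> infdist x M"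
  proof (rule tendsto_sandwich)
    show "\<forall>\<^sub>F n in sequentially. infdist x M \<le> norm (x - m n)"
      using infdist_le[OF m(1)] by (simp add: dist_norm)
    show "\<forall>\<^sub>F n in sequentially. norm (x - m n) \<le> infdist x M + inverse (real (Suc n))"
      using m(2) by (auto simp: dist_norm less_imp_le)
    show "(\<lambda>n. infdist x M + inverse (real (Suc n))) \<longlonglongrightarrow> infdist x M"
      using tendsto_add[OF tendsto_const LIMSEQ_inverse_real_of_nat] by simp
  qed simp
  with m(1) that show thesis by blast
qed

section \<open>Maximal ideals and their characters\<close>

context comm_subalgebra
begin

definition ideal :: "'a set \<Rightarrow> bool" where
  "ideal J \<longleftrightarrow> J \<subseteq> C \<and> 0 \<in> J \<and> (\<forall>x\<in>J. \<forall>y\<in>J. x + y \<in> J) \<and> (\<forall>c\<in>C. \<forall>x\<in>J. c * x \<in> J)"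

lemma idealD:
  assumes "ideal J"
  shows "0 \<in> J" "x \<in> J \<Longrightarrow> x \<in> C" "x \<in> J \<Longrightarrow> y \<in> J \<Longrightarrow> x + y \<in> J" "c \<in> C \<Longrightarrow> x \<in> J \<Longrightarrow> c * x \<in> J"
  using assms by (auto simp: ideal_def)

lemma ideal_scale:
  assumes "ideal J" and "x \<in> J"
  shows "c *\<^sub>C x \<in> J"
  using idealD(4)[OF assms(1) scale[OF one] assms(2), of c] by (simp add: mult_scaleC_left)

lemma ideal_diff:
  assumes "ideal J" and "x \<in> J" and "y \<in> J"
  shows "x - y \<in> J"
  using idealD(3)[OF assms(1,2), of "- y"] idealD(4)[OF assms(1) uminus[OF one] assms(3)] by simp

text \<open>Zorn's lemma for the proper ideals above \<open>I\<close>. Maximality is recorded in the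
  only form used later: the quotient of \<open>C\<close> by \<open>M\<close> is a field.\<close>

lemma maximal_ideal_exists:
  assumes "ideal I" and "1 \<notin> I"
  obtains M where "I \<subseteq> M" and "ideal M" and "1 \<notin> M"
    and "\<And>c. c \<in> C \<Longrightarrow> c \<notin> M \<Longrightarrow> \<exists>r\<in>C. c * r - 1 \<in> M"
proof -
  let ?F = "{J. I \<subseteq> J \<and> ideal J \<and> 1 \<notin> J}"
  have "\<exists>M\<in>?F. \<forall>X\<in>?F. M \<subseteq> X \<longrightarrow> X = M"
  proof (rule subset_Zorn_nonempty)
    show "?F \<noteq> {}" using assms by blast
    fix \<C> assume ne: "\<C> \<noteq> {}" and chain: "subset.chain ?F \<C>"
    have sub: "\<And>J. J \<in> \<C> \<Longrightarrow> I \<subseteq> J \<and> ideal J \<and> 1 \<notin> J"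
      using chain by (auto simp: subset.chain_def)
    have "x + y \<in> \<Union>\<C>" if xy: "x \<in> \<Union>\<C>" "y \<in> \<Union>\<C>" for x y
    proof -
      obtain J K where JK: "J \<in> \<C>" "K \<in> \<C>" "x \<in> J" "y \<in> K" using xy by blast
      then have "J \<subseteq> K \<or> K \<subseteq> J" using chain by (auto simp: subset.chain_def)
      then show ?thesis using JK sub idealD(3) by (metis Union_iff subsetD)
    qed
    moreover have "c * x \<in> \<Union>\<C>" if "c \<in> C" "x \<in> \<Union>\<C>" for c x
      using that sub idealD(4) by blast
    moreover have "0 \<in> \<Union>\<C>" "\<Union>\<C> \<subseteq> C" "I \<subseteq> \<Union>\<C>" "1 \<notin> \<Union>\<C>"
      using ne sub idealD(1,2) by blast+
    ultimately show "\<Union>\<C> \<in> ?F" by (simp add: ideal_def)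
  qed
  then obtain M where M: "I \<subseteq> M" "ideal M" "1 \<notin> M"
    and max: "\<And>X. I \<subseteq> X \<Longrightarrow> ideal X \<Longrightarrow> 1 \<notin> X \<Longrightarrow> M \<subseteq> X \<Longrightarrow> X = M" by auto
  show thesis
  proof (rule that[OF M])
    fix c assume c: "c \<in> C" "c \<notin> M"
    \<comment> \<open>The ideal generated by \<open>M\<close> and \<open>c\<close>; by maximality it
      must contain 1.\<close>
    let ?X = "{m + c * r |m r. m \<in> M \<and> r \<in> C}"
    have MX: "M \<subseteq> ?X" using zero by force
    have "ideal ?X"
      unfolding ideal_def
    proof (intro conjI ballI)
      show "?X \<subseteq> C" using idealD(2)[OF M(2)] c by (auto intro!: closed)
      show "0 \<in> ?X" using MX idealD(1)[OF M(2)] by blast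
      fix x assume x: "x \<in> ?X"
      then obtain m r where mr: "x = m + c * r" "m \<in> M" "r \<in> C" by blast
      show "x + y \<in> ?X" if y: "y \<in> ?X" for y
      proof -
        obtain n s where "y = n + c * s" "n \<in> M" "s \<in> C" using y by blast
        then have "x + y = (m + n) + c * (r + s)" "m + n \<in> M" "r + s \<in> C"
          using mr idealD(3)[OF M(2)] by (auto simp: algebra_simps closed)
        then show ?thesis by blast
      qed
      show "d * x \<in> ?X" if "d \<in> C" for d
      proof -
        have "d * x = d * m + c * (d * r)" "d * m \<in> M" "d * r \<in> C"
          using mr that c idealD(4)[OF M(2)] by (auto simp: distrib_left left_comm closed)
        then show ?thesis by blast
      qed
    qed
    moreover have "c = 0 + c * 1" by simp
    then have "c \<in> ?X" using idealD(1)[OF M(2)] one by blast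
    then have "?X \<noteq> M" using c by blast
    ultimately have "1 \<in> ?X" using max[of ?X] MX M(1) by blast
    then obtain m r where mr: "1 = m + c * r" "m \<in> M" "r \<in> C" by blast
    have "c * r - 1 = (- 1) * m" using mr(1) by (simp add: algebra_simps)
    then show "\<exists>r\<in>C. c * r - 1 \<in> M"
      using mr idealD(4)[OF M(2) uminus[OF one]] by metis
  qed
qed

end

text \<open>Inverses are taken in the whole Banach algebra, where elements near 1 have them;
  fullness brings them back to \<open>C\<close>, so that a proper ideal of \<open>C\<close> stays
  away from 1.\<close>

locale full_comm_subalgebra = comm_subalgebra C for C :: "'a::cbanach_algebra set" +
  assumes inverse_closed: "y \<in> C \<Longrightarrow> y * z = 1 \<Longrightarrow> z * y = 1 \<Longrightarrow> z \<in> C"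
begin

text \<open>For m, m' in M the product (x - m) (y - m') differs from x y by an element of M, which
  gives submultiplicativity. The unit has distance at least 1, since an element of M nearer to 1
  would be invertible and M would not be proper.\<close>

lemma infdist_ideal_seminorm:
  assumes M: "ideal M" "1 \<notin> M"
  shows "subalgebra_seminorm C (\<lambda>x. infdist x M)"
proof
  have ne: "M \<noteq> {}" using idealD(1)[OF M(1)] by blast
  fix x y :: 'a and c :: complex
  show "0 \<le> infdist x M" by (rule infdist_nonneg)
  have le: "infdist z M \<le> norm (z - m)" if "m \<in> M" for z m
    using infdist_le[OF that, of z] by (simp add: dist_norm)
  obtain m where m: "\<And>n. m n \<in> M" "(\<lambda>n::nat. norm (x - m n)) \<longlonglongrightarrow> infdist x M"
    by (rule infdist_sequence[OF ne, of x]) (rule that)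
  obtain m' where m': "\<And>n. m' n \<in> M" "(\<lambda>n::nat. norm (y - m' n)) \<longlonglongrightarrow> infdist y M"
    by (rule infdist_sequence[OF ne, of y]) (rule that)
  show "infdist (x + y) M \<le> infdist x M + infdist y M"
  proof (rule LIMSEQ_le_const[OF tendsto_add[OF m(2) m'(2)]], intro exI allI impI)
    fix n
    have "infdist (x + y) M \<le> norm (x + y - (m n + m' n))"
      using m(1) m'(1) by (intro le idealD(3)[OF M(1)])
    also have "\<dots> \<le> norm (x - m n) + norm (y - m' n)"
      using norm_triangle_ineq[of "x - m n" "y - m' n"] by (simp add: algebra_simps)
    finally show "infdist (x + y) M \<le> norm (x - m n) + norm (y - m' n)" .
  qed
  have scale_le: "infdist (d *\<^sub>C z) M \<le> cmod d * infdist z M" for d z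
  proof -
    obtain k where k: "\<And>n. k n \<in> M" "(\<lambda>n::nat. norm (z - k n)) \<longlonglongrightarrow> infdist z M"
      by (rule infdist_sequence[OF ne, of z]) (rule that)
    show ?thesis
    proof (rule LIMSEQ_le_const[OF tendsto_mult_left[OF k(2)]], intro exI allI impI)
      fix n
      have "infdist (d *\<^sub>C z) M \<le> norm (d *\<^sub>C z - d *\<^sub>C k n)"
        using k(1) by (intro le ideal_scale[OF M(1)])
      then show "infdist (d *\<^sub>C z) M \<le> cmod d * norm (z - k n)"
        by (simp add: norm_scaleC flip: complex_vector.scale_right_diff_distrib)
    qed
  qed
  show "infdist (c *\<^sub>C x) M = cmod c * infdist x M"
  proof (cases "c = 0")
    case True
    then show ?thesis using scale_le[of 0 x] infdist_nonneg[of "0 *\<^sub>C x" M] by simp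
  next
    case False
    have "infdist x M \<le> cmod (inverse c) * infdist (c *\<^sub>C x) M"
      using scale_le[of "inverse c" "c *\<^sub>C x"] False by (simp add: scaleC_scaleC scaleC_one)
    then show ?thesis
      using scale_le[of c x] False by (simp add: norm_inverse norm_divide field_simps)
  qed
  show "infdist (x * y) M \<le> infdist x M * infdist y M" if "x \<in> C" "y \<in> C"
  proof (rule LIMSEQ_le_const[OF tendsto_mult[OF m(2) m'(2)]], intro exI allI impI)
    fix n
    have C: "m n \<in> C" "m' n \<in> C" using m(1) m'(1) idealD(2)[OF M(1)] by auto
    have "(x - m n) * m' n + y * m n \<in> M"
      using m(1) m'(1) that C by (intro idealD(3)[OF M(1)] idealD(4)[OF M(1)] closed)
    then have "infdist (x * y) M \<le> norm (x * y - ((x - m n) * m' n + y * m n))"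
      by (rule le)
    also have "x * y - ((x - m n) * m' n + y * m n) = (x - m n) * (y - m' n)"
      using that C by (simp add: algebra_simps comm)
    also have "norm \<dots> \<le> norm (x - m n) * norm (y - m' n)" by (rule norm_mult_ineq)
    finally show "infdist (x * y) M \<le> norm (x - m n) * norm (y - m' n)" .
  qed
  have "1 \<le> infdist 1 M"
  proof (rule ccontr)
    assume "\<not> 1 \<le> infdist 1 M"
    then have lt: "infdist 1 M < 1" by simp
    obtain k where k: "\<And>n. k n \<in> M" "(\<lambda>n::nat. norm (1 - k n)) \<longlonglongrightarrow> infdist 1 M"
      by (rule infdist_sequence[OF ne, of 1]) (rule that)
    obtain n where "norm (1 - k n) < 1"
      using order_tendstoD(2)[OF k(2) lt] by (auto simp: eventually_sequentially)
    then obtain z where z: "k n * z = 1" "z * k n = 1" using near_one_invertible by blast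
    then have "z \<in> C" using inverse_closed k(1) idealD(2)[OF M(1)] by blast
    then have "1 \<in> M" using idealD(4)[OF M(1) _ k(1)] z by metis
    then show False using M by blast
  qed
  then show "infdist 1 M \<noteq> 0" by simp
qed

text \<open>The scalar is the value at \<open>c\<close> of the character with kernel
  \<open>M\<close>. Membership in \<open>M\<close> itself follows, not merely distance 0: outside
  \<open>M\<close> there are inverses modulo \<open>M\<close>, and these are also inverses modulo
  the null space of the distance.\<close>

lemma maximal_ideal_scalar:
  assumes M: "ideal M" "1 \<notin> M" "\<And>c. c \<in> C \<Longrightarrow> c \<notin> M \<Longrightarrow> \<exists>r\<in>C. c * r - 1 \<in> M" and c: "c \<in> C"
  obtains \<mu> where "c - \<mu> *\<^sub>C 1 \<in> M"
proof -
  interpret subalgebra_seminorm C "\<lambda>x. infdist x M"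
    by (rule infdist_ideal_seminorm[OF M(1,2)])
  obtain \<mu> where \<mu>: "\<nexists>r. qinv (c - \<mu> *\<^sub>C 1) r" using gelfand_mazur[OF c] by blast
  have C: "c - \<mu> *\<^sub>C 1 \<in> C" using c by (intro closed)
  have "c - \<mu> *\<^sub>C 1 \<in> M"
  proof (rule ccontr)
    assume "c - \<mu> *\<^sub>C 1 \<notin> M"
    then obtain r where "r \<in> C" "(c - \<mu> *\<^sub>C 1) * r - 1 \<in> M" using M(3) C by blast
    then have "qinv (c - \<mu> *\<^sub>C 1) r" using C by (simp add: qinv_def)
    with \<mu> show False by blast
  qed
  then show thesis by (rule that)
qed

text \<open>Induction on i + j with e and g arbitrary. One factor of the power turns e g into (u e)
  (d g) + \<mu> e (v g); passing from e to u e, or from g to v g, lowers i or j by one. If i or j is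
  0, then e or g vanishes.\<close>

lemma power_mult_eq_0:
  assumes C: "u \<in> C" "v \<in> C" "d \<in> C"
  shows "e \<in> C \<Longrightarrow> g \<in> C \<Longrightarrow> u ^ i * e = 0 \<Longrightarrow> v ^ j * g = 0 \<Longrightarrow>
    (u * d + \<mu> *\<^sub>C v) ^ (i + j) * (e * g) = 0"
proof (induction "i + j" arbitrary: i j e g)
  case 0
  then show ?case by simp
next
  case (Suc n)
  show ?case
  proof (cases "i = 0 \<or> j = 0")
    case True
    then show ?thesis using Suc.prems by auto
  next
    case False
    then obtain i' j' where ij: "i = Suc i'" "j = Suc j'" by (meson not0_implies_Suc)
    let ?x = "u * d + \<mu> *\<^sub>C v"
    have "u ^ i' * (u * e) = 0" using Suc.prems(3) C by (simp add: ij left_comm comm closed power_commutes flip: mult.assoc)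
    moreover have "v ^ j * (d * g) = d * (v ^ j * g)"
      using C Suc.prems(2) by (simp add: left_comm closed)
    ultimately have 1: "?x ^ (i' + j) * ((u * e) * (d * g)) = 0"
      using Suc C by (intro Suc.hyps(1)) (auto simp: ij closed)
    have "v ^ j' * (v * g) = 0" using Suc.prems(4) C by (simp add: ij power_commutes flip: mult.assoc)
    then have 2: "?x ^ (i + j') * (e * (v * g)) = 0"
      using Suc C by (intro Suc.hyps(1)) (auto simp: ij closed)
    have "?x ^ (i + j) * (e * g) = ?x ^ (i' + j) * (?x * (e * g))"
      by (simp only: ij add_Suc power_Suc2 mult.assoc)
    also have "?x * (e * g) = (u * e) * (d * g) + \<mu> *\<^sub>C (e * (v * g))"
      using C Suc.prems(1,2)
      by (simp add: distrib_right mult_scaleC_left left_comm closed mult.assoc)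
    also have "?x ^ (i' + j) * \<dots> = 0"
      using 1 2 by (simp add: distrib_left mult_scaleC_right ij)
    finally show ?thesis .
  qed
qed

end

text \<open>Here \<open>s\<close> is a Drazin inverse of index at most 1. The element
  \<open>1 - b * s\<close> is then an idempotent annihilated by \<open>b\<close>: the algebraic form
  of a spectral projection.\<close>

definition group_invertible :: "'a::cbanach_algebra \<Rightarrow> bool" where
  "group_invertible b \<longleftrightarrow> (\<exists>s. b * s = s * b \<and> b * b * s = b \<and> s * s * b = s)"

text \<open>Both d s and s d reduce to s b d s. The lemma keeps group inverses, and with them the
  idempotents, inside the bicommutant.\<close>

lemma group_inverse_commutes:
  fixes b s d :: "'a::cbanach_algebra"
  assumes "b * s = s * b" "b * b * s = b" "s * s * b = s" and "d * b = b * d"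
  shows "d * s = s * d"
proof -
  have l: "s * d = s * b * d * s"
  proof -
    have "s * d = s * s * (b * d)" using assms(3) by (metis mult.assoc)
    also have "\<dots> = s * s * (d * (b * b * s))" using assms(2,4) by metis
    also have "\<dots> = s * s * (b * b * d * s)" using assms(4) by (metis mult.assoc)
    also have "\<dots> = s * b * d * s" using assms(1,3) by (metis mult.assoc)
    finally show ?thesis .
  qed
  have "d * s = d * b * (s * s)" using assms(1,3) by (metis mult.assoc)
  also have "\<dots> = s * b * b * d * (s * s)" using assms(1,2,4) by (metis mult.assoc)
  also have "\<dots> = s * b * (d * (b * s * s))" using assms(4) by (metis mult.assoc)
  also have "\<dots> = s * b * d * s" using assms(1,3) by (metis mult.assoc)
  finally show ?thesis using l by simp
qed

theorem commuting_product_power: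
  fixes P Q :: "'a::cbanach_algebra"
  assumes PQ: "P * Q = Q * P"
    and poles: "\<And>\<mu> \<nu>. \<mu> * \<nu> = \<zeta> \<Longrightarrow>
      (\<nexists>z. (P - \<mu> *\<^sub>C 1) * z = 1 \<and> z * (P - \<mu> *\<^sub>C 1) = 1) \<Longrightarrow>
      (\<nexists>z. (Q - \<nu> *\<^sub>C 1) * z = 1 \<and> z * (Q - \<nu> *\<^sub>C 1) = 1) \<Longrightarrow>
      (\<exists>i>0. group_invertible ((P - \<mu> *\<^sub>C 1) ^ i)) \<and> (\<exists>j>0. group_invertible ((Q - \<nu> *\<^sub>C 1) ^ j))"
  shows "\<exists>n a. (P * Q - \<zeta> *\<^sub>C 1) ^ n = (P * Q - \<zeta> *\<^sub>C 1) ^ Suc n * a \<and>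
    a * (P * Q - \<zeta> *\<^sub>C 1) = (P * Q - \<zeta> *\<^sub>C 1) * a"
proof -
  define x where "x = P * Q - \<zeta> *\<^sub>C 1"
  define C where "C = {c. \<forall>d. d * P = P * d \<longrightarrow> d * Q = Q * d \<longrightarrow> c * d = d * c}"
  have CI: "(\<And>d. d * P = P * d \<Longrightarrow> d * Q = Q * d \<Longrightarrow> c * d = d * c) \<Longrightarrow> c \<in> C" for c
    by (simp add: C_def)
  have CD: "c \<in> C \<Longrightarrow> d * P = P * d \<Longrightarrow> d * Q = Q * d \<Longrightarrow> c * d = d * c" for c d
    by (simp add: C_def)
  have P: "P \<in> C" and Q: "Q \<in> C" by (auto simp: C_def)
  interpret full_comm_subalgebra C
  proof
    show "1 \<in> C" by (simp add: C_def)
    show "y + z \<in> C" "y * z \<in> C" "y * z = z * y" if "y \<in> C" "z \<in> C" for y z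
    proof -
      show "y + z \<in> C" using that by (simp add: C_def distrib_left distrib_right)
      show "y * z \<in> C" using that by (intro CI) (metis CD mult.assoc)
      have "z * P = P * z" "z * Q = Q * z" using CD[OF that(2)] PQ by auto
      then show "y * z = z * y" by (rule CD[OF that(1)])
    qed
    show "c *\<^sub>C y \<in> C" if "y \<in> C" for c y
      using that by (simp add: C_def mult_scaleC_left mult_scaleC_right)
    show "z \<in> C" if "y \<in> C" "y * z = 1" "z * y = 1" for y z
    proof (rule CI)
      fix d assume "d * P = P * d" "d * Q = Q * d"
      then have "y * d = d * y" by (rule CD[OF that(1)])
      then show "z * d = d * z" using that(2,3) by (metis mult.assoc mult_1_left mult_1_right)
    qed
  qed
  have x: "x \<in> C" unfolding x_def using P Q by (intro closed)
  \<comment> \<open>The annihilators of the powers of \<open>x\<close> form an increasing chain, so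
    their union is closed under sums. No closure is taken, because 1 is to be written exactly as
    \<open>x * r + c\<close>.\<close>
  define I where "I = {x * r + c |r c. r \<in> C \<and> c \<in> C \<and> (\<exists>n. x ^ n * c = 0)}"
  have ann_add: "\<exists>n. x ^ n * (c + d) = 0" if "x ^ i * c = 0" "x ^ j * d = 0" for c d i j
  proof -
    have "x ^ (i + j) * c = x ^ j * (x ^ i * c)" "x ^ (i + j) * d = x ^ i * (x ^ j * d)"
      by (metis add.commute mult.assoc power_add)+
    then have "x ^ (i + j) * (c + d) = 0" using that by (simp add: distrib_left)
    then show ?thesis ..
  qed
  have I: "ideal I"
    unfolding ideal_def
  proof (intro conjI ballI)
    show "I \<subseteq> C" using x by (auto simp: I_def intro!: closed)
    show "0 \<in> I" unfolding I_def using zero by force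
    fix y assume "y \<in> I"
    then obtain r c n where y: "y = x * r + c" "r \<in> C" "c \<in> C" "x ^ n * c = 0"
      by (auto simp: I_def)
    show "y + z \<in> I" if zI: "z \<in> I" for z
    proof -
      obtain s d m where z: "z = x * s + d" "s \<in> C" "d \<in> C" "x ^ m * d = 0"
        using zI by (auto simp: I_def)
      have "y + z = x * (r + s) + (c + d)" using y z by (simp add: algebra_simps)
      then show ?thesis
        unfolding I_def using y z ann_add[OF y(4) z(4)] closed(3) by blast
    qed
    show "d * y \<in> I" if d: "d \<in> C" for d
    proof -
      have "d * y = x * (d * r) + d * c" using d x y by (simp add: distrib_left left_comm)
      moreover have "x ^ n * (d * c) = 0"
        using left_comm[OF power[OF x] d, of n c] y(4) by simp
      ultimately show ?thesis unfolding I_def using y d closed(5) by blast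
    qed
  qed
  have "1 \<in> I"
  proof (rule ccontr)
    assume "1 \<notin> I"
    with I obtain M where M: "I \<subseteq> M" "ideal M" "1 \<notin> M"
      "\<And>c. c \<in> C \<Longrightarrow> c \<notin> M \<Longrightarrow> \<exists>r\<in>C. c * r - 1 \<in> M"
      by (rule maximal_ideal_exists) (rule that)
    obtain \<mu> where \<mu>: "P - \<mu> *\<^sub>C 1 \<in> M" by (rule maximal_ideal_scalar[OF M(2,3,4) P])
    obtain \<nu> where \<nu>: "Q - \<nu> *\<^sub>C 1 \<in> M" by (rule maximal_ideal_scalar[OF M(2,3,4) Q])
    define u where "u = P - \<mu> *\<^sub>C 1"
    define v where "v = Q - \<nu> *\<^sub>C 1"
    have uv: "u \<in> M" "v \<in> M" "u \<in> C" "v \<in> C" using \<mu> \<nu> idealD(2)[OF M(2)] by (auto simp: u_def v_def)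
    have prod: "P * Q - (\<mu> * \<nu>) *\<^sub>C 1 = u * Q + \<mu> *\<^sub>C v"
      by (simp add: u_def v_def left_diff_distrib mult_scaleC_left
          complex_vector.scale_right_diff_distrib scaleC_scaleC)
    have "x = x * 1 + 0" by simp
    then have "x \<in> I" unfolding I_def using one zero by force
    then have xM: "x \<in> M" using M(1) by blast
    have prodM: "u * Q + \<mu> *\<^sub>C v \<in> M"
      using uv Q comm idealD(4)[OF M(2)] by (intro idealD(3)[OF M(2)] ideal_scale[OF M(2)]) metis+
    \<comment> \<open>The character sends P to \<mu> and Q to \<nu>, hence \<open>x\<close> to \<mu>
      \<nu> - \<zeta>; but \<open>x\<close> lies in its kernel \<open>M\<close>.\<close>
    have \<zeta>: "\<mu> * \<nu> = \<zeta>"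
    proof (rule ccontr)
      assume ne: "\<mu> * \<nu> \<noteq> \<zeta>"
      have "(P * Q - (\<mu> * \<nu>) *\<^sub>C 1) - x \<in> M"
        unfolding prod by (rule ideal_diff[OF M(2) prodM xM])
      then have "(\<zeta> - \<mu> * \<nu>) *\<^sub>C 1 \<in> M"
        by (simp add: x_def complex_vector.scale_left_diff_distrib)
      then have "inverse (\<zeta> - \<mu> * \<nu>) *\<^sub>C ((\<zeta> - \<mu> * \<nu>) *\<^sub>C 1) \<in> M"
        by (rule ideal_scale[OF M(2)])
      moreover have "inverse (\<zeta> - \<mu> * \<nu>) * (\<zeta> - \<mu> * \<nu>) = 1"
        using ne by simp
      ultimately show False using M(3) by (simp only: scaleC_scaleC scaleC_one)
    qed
    \<comment> \<open>Since \<open>C\<close> is full, this is noninvertibility in the whole algebra,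
      as the hypothesis on poles demands.\<close>
    have noninv: "\<nexists>z. y * z = 1 \<and> z * y = 1" if "y \<in> M" for y
      using that inverse_closed idealD(2,4)[OF M(2)] M(3) by metis
    obtain i j where i: "i > 0" "group_invertible (u ^ i)" and j: "j > 0" "group_invertible (v ^ j)"
      using poles[OF \<zeta>] noninv[OF uv(1)] noninv[OF uv(2)] unfolding u_def v_def by blast
    \<comment> \<open>The witness is \<open>1 - y ^ k * s\<close>. It equals 1 modulo
      \<open>M\<close> because \<open>k > 0\<close> lets a factor \<open>y\<close> of
      \<open>y ^ k * s\<close> be split off, and that factor lies in \<open>M\<close>.\<close>
    have idem: "\<exists>e\<in>C. y ^ k * e = 0 \<and> 1 - e \<in> M"
      if k: "k > 0" "group_invertible (y ^ k)" and y: "y \<in> M"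
        and bi: "\<And>d. d * P = P * d \<Longrightarrow> d * Q = Q * d \<Longrightarrow> d * y = y * d" for y k
    proof -
      obtain s where s: "y ^ k * s = s * y ^ k" "y ^ k * y ^ k * s = y ^ k" "s * s * y ^ k = s"
        using k(2) by (auto simp: group_invertible_def)
      have yC: "y \<in> C" using y idealD(2)[OF M(2)] by blast
      have sC: "s \<in> C"
      proof (rule CI)
        fix d assume "d * P = P * d" "d * Q = Q * d"
        then have "d * y = y * d" by (rule bi)
        then have "d * y ^ k = y ^ k * d" by (metis power_commuting_commutes)
        then show "s * d = d * s" using group_inverse_commutes[OF s] by simp
      qed
      have "y ^ k * (1 - y ^ k * s) = 0" using s(2) by (simp add: right_diff_distrib mult.assoc)
      moreover have "1 - (1 - y ^ k * s) \<in> M"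
      proof -
        obtain l where "k = Suc l" using k(1) gr0_conv_Suc by blast
        then have "1 - (1 - y ^ k * s) = (s * y ^ l) * y"
          using s(1) by (simp add: power_commutes mult.assoc)
        then show ?thesis using idealD(4)[OF M(2) _ y] sC yC by (simp add: closed)
      qed
      ultimately show ?thesis using sC yC by (intro bexI[of _ "1 - y ^ k * s"]) (auto intro: closed)
    qed
    obtain e where e: "e \<in> C" "u ^ i * e = 0" "1 - e \<in> M"
      using idem[OF i uv(1)]
      by (auto simp: u_def right_diff_distrib left_diff_distrib mult_scaleC_left mult_scaleC_right)
    obtain g where g: "g \<in> C" "v ^ j * g = 0" "1 - g \<in> M"
      using idem[OF j uv(2)]
      by (auto simp: v_def right_diff_distrib left_diff_distrib mult_scaleC_left mult_scaleC_right)
    have "x ^ (i + j) * (e * g) = 0"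
      using power_mult_eq_0[OF uv(3,4) Q e(1) g(1) e(2) g(2), of \<mu>] prod by (simp add: x_def \<zeta>)
    moreover have "e * g = x * 0 + e * g" by simp
    ultimately have "e * g \<in> I" unfolding I_def using e(1) g(1) closed(2,5) by blast
    then have "e * g \<in> M" using M(1) by blast
    moreover have "e * (1 - g) \<in> M" by (rule idealD(4)[OF M(2) e(1) g(3)])
    ultimately have "(e * (1 - g) + (1 - e)) + e * g \<in> M"
      using e(3) by (intro idealD(3)[OF M(2)])
    then show False using M(3) by (simp add: right_diff_distrib)
  qed
  then obtain r c n where r: "1 = x * r + c" "r \<in> C" "c \<in> C" "x ^ n * c = 0"
    by (auto simp: I_def)
  have "x ^ n = x ^ n * (x * r + c)" by (simp flip: r(1))
  also have "\<dots> = x ^ Suc n * r" using r(4) by (simp add: distrib_left power_commutes flip: mult.assoc)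
  finally have "x ^ n = x ^ Suc n * r" .
  moreover have "r * x = x * r" by (rule comm[OF r(2) x])
  ultimately show ?thesis unfolding x_def by blast
qed

section \<open>The Banach algebra of bounded operators\<close>

lemma cblinfun_apply_id: "cblinfun_apply cblinfun_id x = x"
  by transfer simp

lemma cblinfun_apply_linear:
  "cblinfun_apply F (x + y) = cblinfun_apply F x + cblinfun_apply F y"
  "cblinfun_apply F (x - y) = cblinfun_apply F x - cblinfun_apply F y"
  "cblinfun_apply F 0 = 0"
  using bounded_linear.linear[OF bounded_linear_cblinfun_apply[of F]]
  by (simp_all add: linear_add linear_diff linear_0)

text \<open>
  A copy of \<open>('a, 'a) cblinfun\<close>, as type class instances for that non-linear type pattern
  are not possible.
\<close>

typedef (overloaded) 'a endo = "UNIV :: ('a::cbanach, 'a) cblinfun set"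
  morphisms cblinfun_of_endo Endo
  by simp

setup_lifting type_definition_endo

text \<open>The sort has \<open>monoid_mult\<close> and not \<open>real_normed_algebra_1\<close>: on
  a zero space the identity operator equals 0, so neither \<open>0 \<noteq> 1\<close> nor
  \<open>norm 1 = 1\<close> is available.\<close>

instantiation endo :: (cbanach) "{complex_normed_vector, real_normed_algebra, monoid_mult}"
begin

lift_definition zero_endo :: "'a endo" is 0 .
lift_definition one_endo :: "'a endo" is cblinfun_id .
lift_definition plus_endo :: "'a endo \<Rightarrow> 'a endo \<Rightarrow> 'a endo" is "(+)" .
lift_definition minus_endo :: "'a endo \<Rightarrow> 'a endo \<Rightarrow> 'a endo" is "(-)" .
lift_definition uminus_endo :: "'a endo \<Rightarrow> 'a endo" is uminus .
lift_definition times_endo :: "'a endo \<Rightarrow> 'a endo \<Rightarrow> 'a endo" is "(o\<^sub>C)" .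
lift_definition scaleR_endo :: "real \<Rightarrow> 'a endo \<Rightarrow> 'a endo" is scaleR .
lift_definition scaleC_endo :: "complex \<Rightarrow> 'a endo \<Rightarrow> 'a endo" is scaleC .
lift_definition norm_endo :: "'a endo \<Rightarrow> real" is norm .

definition dist_endo :: "'a endo \<Rightarrow> 'a endo \<Rightarrow> real"
  where "dist_endo f g = norm (f - g)"

definition uniformity_endo :: "('a endo \<times> 'a endo) filter"
  where "uniformity_endo = (INF e\<in>{0<..}. principal {(f, g). dist f g < e})"

definition open_endo :: "'a endo set \<Rightarrow> bool"
  where "open_endo S = (\<forall>f\<in>S. \<forall>\<^sub>F (f', g) in uniformity. f' = f \<longrightarrow> g \<in> S)"

definition sgn_endo :: "'a endo \<Rightarrow> 'a endo"
  where "sgn_endo f = inverse (norm f) *\<^sub>R f"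

instance
proof
  fix f g h :: "'a endo" and r s :: real and c d :: complex
  show "f + g + h = f + (g + h)" "f + g = g + f" "0 + f = f" "- f + f = 0" "f - g = f + - g"
    by (transfer; simp)+
  show "r *\<^sub>R (f + g) = r *\<^sub>R f + r *\<^sub>R g" "(r + s) *\<^sub>R f = r *\<^sub>R f + s *\<^sub>R f"
    "r *\<^sub>R s *\<^sub>R f = (r * s) *\<^sub>R f" "1 *\<^sub>R f = f"
    by (transfer; simp add: algebra_simps)+
  show "c *\<^sub>C (f + g) = c *\<^sub>C f + c *\<^sub>C g" "(c + d) *\<^sub>C f = c *\<^sub>C f + d *\<^sub>C f"
    "c *\<^sub>C d *\<^sub>C f = (c * d) *\<^sub>C f" "1 *\<^sub>C f = f" "r *\<^sub>R f = complex_of_real r *\<^sub>C f"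
    "norm (c *\<^sub>C f) = cmod c * norm f"
    by (transfer; simp add: scaleC_add_right scaleC_add_left scaleC_scaleC scaleC_one scaleR_scaleC
        norm_scaleC)+
  show "dist f g = norm (f - g)" "sgn f = inverse (norm f) *\<^sub>R f"
    "(uniformity :: ('a endo \<times> 'a endo) filter) = (INF e\<in>{0<..}. principal {(f, g). dist f g < e})"
    by (rule dist_endo_def sgn_endo_def uniformity_endo_def)+
  show "open U = (\<forall>f\<in>U. \<forall>\<^sub>F (f', g) in uniformity. f' = f \<longrightarrow> g \<in> U)" for U :: "'a endo set"
    by (rule open_endo_def)
  show "(norm f = 0) = (f = 0)" "norm (r *\<^sub>R f) = \<bar>r\<bar> * norm f"
    by (transfer; simp)+
  show "norm (f + g) \<le> norm f + norm g" by transfer (rule norm_triangle_ineq)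
  show "norm (f * g) \<le> norm f * norm g" by transfer (rule norm_cblinfun_compose)
  show "f * g * h = f * (g * h)" "1 * f = f" "f * 1 = f" "(f + g) * h = f * h + g * h"
    "f * (g + h) = f * g + f * h"
    "(r *\<^sub>R f) * g = r *\<^sub>R (f * g)" "f * (r *\<^sub>R g) = r *\<^sub>R (f * g)"
    by (transfer; rule cblinfun_eqI; simp add: cblinfun_apply_compose cblinfun_apply_add
        cblinfun_apply_linear cblinfun_apply_scaleC cblinfun_apply_scaleC_right scaleR_scaleC
        cblinfun_apply_id)+
qed

end

instance endo :: (cbanach) cbanach_algebra
proof
  fix f g :: "'a endo" and c :: complex
  show "(c *\<^sub>C f) * g = c *\<^sub>C (f * g)" "f * (c *\<^sub>C g) = c *\<^sub>C (f * g)"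
    by (transfer; rule cblinfun_eqI; simp add: cblinfun_apply_compose cblinfun_apply_scaleC
        cblinfun_apply_scaleC_right)+
next
  fix X :: "nat \<Rightarrow> 'a endo"
  assume "Cauchy X"
  have dist: "dist (cblinfun_of_endo f) (cblinfun_of_endo g) = dist f g" for f g :: "'a endo"
    unfolding dist_norm by transfer simp
  have "Cauchy (\<lambda>n. cblinfun_of_endo (X n))"
    using \<open>Cauchy X\<close> by (simp add: Cauchy_def dist)
  then obtain L where "(\<lambda>n. cblinfun_of_endo (X n)) \<longlonglongrightarrow> L"
    using Cauchy_convergent convergent_def by blast
  then have "X \<longlonglongrightarrow> Endo L"
    using dist by (simp add: LIMSEQ_def) (metis UNIV_I Endo_inverse)
  then show "convergent X"
    unfolding convergent_def by blast
qed

lemma cblinfun_apply_endo_power: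
  "cblinfun_apply (cblinfun_of_endo (Endo T ^ n)) = (cblinfun_apply T ^^ n)"
proof (induction n)
  case 0
  then show ?case by (simp add: one_endo.rep_eq cblinfun_apply_id fun_eq_iff)
next
  case (Suc n)
  then show ?case
    by (simp add: times_endo.rep_eq cblinfun_apply_compose Endo_inverse fun_eq_iff)
qed

lemma Endo_diff: "Endo (A - B) = Endo A - Endo B"
  and Endo_scaleC: "Endo (c *\<^sub>C A) = c *\<^sub>C Endo A"
  and Endo_compose: "Endo (A o\<^sub>C B) = Endo A * Endo B"
  and Endo_id: "Endo cblinfun_id = 1"
  by (simp_all add: cblinfun_of_endo_inject[symmetric] minus_endo.rep_eq scaleC_endo.rep_eq
      times_endo.rep_eq one_endo.rep_eq Endo_inverse)

lemma cspectrum_endo: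
  "\<mu> \<in> cspectrum T \<longleftrightarrow> (\<nexists>z. (Endo T - \<mu> *\<^sub>C 1) * z = 1 \<and> z * (Endo T - \<mu> *\<^sub>C 1) = 1)"
proof -
  let ?T = "T - \<mu> *\<^sub>C cblinfun_id"
  have E: "Endo T - \<mu> *\<^sub>C 1 = Endo ?T" by (simp add: Endo_diff Endo_scaleC Endo_id)
  have "(\<exists>z. Endo ?T * z = 1 \<and> z * Endo ?T = 1) \<longleftrightarrow> (\<exists>S. Endo ?T * Endo S = 1 \<and> Endo S * Endo ?T = 1)"
    by (rule iffI; metis cblinfun_of_endo_inverse)
  also have "\<dots> \<longleftrightarrow> (\<exists>S. ?T o\<^sub>C S = cblinfun_id \<and> S o\<^sub>C ?T = cblinfun_id)"
    by (simp add: Endo_compose[symmetric] Endo_inject flip: Endo_id)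
  finally show ?thesis unfolding E by (auto simp: cspectrum_def)
qed

section \<open>Finite ascent and descent\<close>

text \<open>The open mapping theorem for the restriction of \<open>f\<close> to a closed subspace:
  Baire category gives approximate preimages of controlled norm, and a geometric series of
  corrections makes them exact.\<close>

lemma open_mapping_bound:
  fixes f :: "'a::banach \<Rightarrow> 'b::banach"
  assumes f: "bounded_linear f" and S: "closed S" "subspace S" and surj: "f ` S = UNIV"
  obtains K where "0 < K" and "\<And>y. \<exists>x\<in>S. f x = y \<and> norm x \<le> K * norm y"
proof -
  interpret f: bounded_linear f by (rule f)
  define F where "F n = closure (f ` (S \<inter> cball 0 (real n)))" for n
  have "\<exists>n. interior (F n) \<noteq> {}"
  proof (rule ccontr)
    assume no: "\<not> ?thesis"
    have "euclidean interior_of \<Union>(range F) = {}"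
      by (rule Baire_category_alt)
        (use no in \<open>auto simp: completely_metrizable_space_euclidean F_def\<close>)
    moreover have "\<Union>(range F) = UNIV"
    proof -
      have "y \<in> \<Union>(range F)" for y
      proof -
        obtain x where x: "x \<in> S" "f x = y" using surj by (metis UNIV_I imageE)
        obtain n :: nat where "norm x \<le> n" using real_arch_simple by blast
        then have "y \<in> F n" unfolding F_def using x closure_subset by force
        then show ?thesis by blast
      qed
      then show ?thesis by blast
    qed
    ultimately show False by simp
  qed
  then obtain n y0 \<epsilon> where \<epsilon>: "0 < \<epsilon>" "ball y0 \<epsilon> \<subseteq> F n"
    by (metis ex_in_conv mem_interior)
  \<comment> \<open>A vector near 0 is the difference of two points of the ball around
    \<open>y0\<close>, hence the factor 2 in the bound.\<close>
  have approx: "\<exists>x\<in>S. norm x \<le> 2 * real n \<and> norm (y - f x) < \<delta>" if y: "norm y < \<epsilon>" and \<delta>: "0 < \<delta>" for y \<delta>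
  proof -
    have "y0 + y \<in> F n" "y0 \<in> F n" using \<epsilon> y by (auto simp: subset_iff dist_norm)
    moreover have "\<exists>u\<in>S. norm u \<le> n \<and> dist (f u) z < \<delta> / 2" if z: "z \<in> F n" for z
    proof -
      obtain p where "p \<in> f ` (S \<inter> cball 0 (real n))" "dist p z < \<delta> / 2"
        using z half_gt_zero[OF \<delta>] unfolding F_def closure_approachable by meson
      then show ?thesis by auto
    qed
    ultimately obtain u v where uv: "u \<in> S" "norm u \<le> n" "dist (f u) (y0 + y) < \<delta> / 2"
        "v \<in> S" "norm v \<le> n" "dist (f v) y0 < \<delta> / 2"
      by meson
    have "norm (y - f (u - v)) = norm ((f v - y0) - (f u - (y0 + y)))"
      by (simp add: f.diff algebra_simps)
    also have "\<dots> < \<delta> / 2 + \<delta> / 2"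
      using uv norm_triangle_ineq4[of "f v - y0" "f u - (y0 + y)"] by (simp add: dist_norm)
    finally have "norm (y - f (u - v)) < \<delta>" by simp
    moreover have "norm (u - v) \<le> 2 * real n"
      using uv norm_triangle_ineq4[of u v] by simp
    ultimately show ?thesis using uv subspace_diff[OF S(2)] by blast
  qed
  \<comment> \<open>Rescaling \<open>y\<close> to norm \<epsilon> / 2 turns the bound 2 n into 4 n *
    norm y / \<epsilon>; the summand 1 makes \<open>K\<close> positive also for n = 0.\<close>
  define K where "K = 4 * real n / \<epsilon> + 1"
  have K: "0 < K" using \<epsilon>(1) by (simp add: K_def add_nonneg_pos)
  have half: "\<exists>x\<in>S. norm x \<le> K * norm y \<and> norm (y - f x) \<le> norm y / 2" for y
  proof (cases "y = 0")
    case True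
    then show ?thesis using subspace_0[OF S(2)] by (intro bexI[of _ 0]) (auto simp: f.zero)
  next
    case False
    define t where "t = \<epsilon> / (2 * norm y)"
    have t: "0 < t" using \<epsilon>(1) False by (simp add: t_def)
    have "norm (t *\<^sub>R y) < \<epsilon>" using \<epsilon>(1) False by (simp add: t_def)
    moreover have "0 < t * (norm y / 2)" using t False by simp
    ultimately obtain x where x: "x \<in> S" "norm x \<le> 2 * real n" "norm (t *\<^sub>R y - f x) < t * (norm y / 2)"
      using approx by blast
    have "norm (inverse t *\<^sub>R x) \<le> K * norm y"
    proof -
      have "norm (inverse t *\<^sub>R x) \<le> inverse t * (2 * real n)" using x(2) t by simp
      also have "\<dots> = 4 * real n / \<epsilon> * norm y" using \<epsilon>(1) False by (simp add: t_def)
      also have "\<dots> \<le> K * norm y" by (intro mult_right_mono) (simp_all add: K_def)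
      finally show ?thesis .
    qed
    moreover have "norm (y - f (inverse t *\<^sub>R x)) \<le> norm y / 2"
    proof -
      have "y - f (inverse t *\<^sub>R x) = inverse t *\<^sub>R (t *\<^sub>R y - f x)"
        using t by (simp add: f.scaleR scaleR_diff_right)
      then have "norm (y - f (inverse t *\<^sub>R x)) = inverse t * norm (t *\<^sub>R y - f x)"
        using t by simp
      also have "\<dots> \<le> inverse t * (t * (norm y / 2))"
        using x(3) t by (intro mult_left_mono) auto
      also have "\<dots> = norm y / 2" using t by (simp add: field_simps)
      finally show ?thesis .
    qed
    ultimately show ?thesis using x(1) subspace_scale[OF S(2)] by blast
  qed
  then obtain g where g: "\<And>y. g y \<in> S" "\<And>y. norm (g y) \<le> K * norm y"
    "\<And>y. norm (y - f (g y)) \<le> norm y / 2" by metis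
  show thesis
  proof (rule that[of "2 * K"])
    show "0 < 2 * K" using K by simp
    fix y
    \<comment> \<open>The residual after k corrections; each correction at least halves its
      norm.\<close>
    define r where "r k = ((\<lambda>z. z - f (g z)) ^^ k) y" for k
    have r: "norm (r k) \<le> norm y * (1 / 2) ^ k" for k
    proof (induction k)
      case (Suc k)
      then show ?case using g(3)[of "r k"] by (simp add: r_def)
    qed (simp add: r_def)
    have gr: "norm (g (r k)) \<le> K * norm y * (1 / 2) ^ k" for k
      using order_trans[OF g(2)[of "r k"] mult_left_mono[OF r[of k], of K]] K by (simp add: mult.assoc)
    have geo: "(\<lambda>k. K * norm y * (1 / 2) ^ k) sums (2 * K * norm y)"
      using sums_mult[OF geometric_sums[of "1 / 2 :: real"], of "K * norm y"] by (simp add: mult_ac)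
    have sum_norm: "summable (\<lambda>k. norm (g (r k)))"
      by (rule summable_comparison_test'[OF sums_summable[OF geo]]) (simp add: gr)
    have sum: "summable (\<lambda>k. g (r k))" by (rule summable_norm_cancel[OF sum_norm])
    define x where "x = (\<Sum>k. g (r k))"
    have lim: "(\<lambda>N. \<Sum>k<N. g (r k)) \<longlonglongrightarrow> x"
      using summable_LIMSEQ[OF sum] by (simp add: x_def)
    have "x \<in> S"
      by (rule closed_sequentially[OF S(1) _ lim]) (simp add: subspace_sum[OF S(2)] g(1))
    moreover have "f x = y"
    proof (rule LIMSEQ_unique[OF f.tendsto[OF lim]])
      have "f (\<Sum>k<N. g (r k)) = y - r N" for N
        by (induction N) (simp_all add: f.zero f.add r_def)
      moreover have "r \<longlonglongrightarrow> 0"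
        by (rule Lim_null_comparison[of _ "\<lambda>k. norm y * (1 / 2) ^ k"])
          (auto simp: r intro!: tendsto_eq_intros LIMSEQ_power_zero)
      then have "(\<lambda>N. y - r N) \<longlonglongrightarrow> y - 0" by (intro tendsto_intros)
      ultimately show "(\<lambda>N. f (\<Sum>k<N. g (r k))) \<longlonglongrightarrow> y" by simp
    qed
    moreover have "norm x \<le> 2 * K * norm y"
    proof -
      have "norm x \<le> (\<Sum>k. norm (g (r k)))" unfolding x_def by (rule summable_norm[OF sum_norm])
      also have "\<dots> \<le> (\<Sum>k. K * norm y * (1 / 2) ^ k)"
        by (rule suminf_le[OF gr sum_norm sums_summable[OF geo]])
      also have "\<dots> = 2 * K * norm y" by (rule sums_unique[OF geo, symmetric])
      finally show ?thesis .
    qed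
    ultimately show "\<exists>x\<in>S. f x = y \<and> norm x \<le> 2 * K * norm y" by blast
  qed
qed

text \<open>The hypotheses make the space the algebraic direct sum of N(b) and R(b), with b
  bijective on R(b). The group inverse inverts b on R(b) and vanishes on N(b): it maps x to the
  unique y in R(b) with b b y = b x. Its boundedness comes from the open mapping theorem for (u, v)
  -> u + b v on the closed subspace of pairs with b u = 0.\<close>

lemma group_inverse_exists:
  fixes b :: "('z::cbanach, 'z) cblinfun"
  assumes null: "\<And>x. cblinfun_apply b (cblinfun_apply b x) = 0 \<Longrightarrow> cblinfun_apply b x = 0"
    and range: "\<And>x. \<exists>v. cblinfun_apply b x = cblinfun_apply b (cblinfun_apply b v)"
  shows "group_invertible (Endo b)"
proof -
  define f where "f = cblinfun_apply b"
  interpret f: bounded_linear f unfolding f_def by (rule bounded_linear_cblinfun_apply)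
  have f_scale: "f (c *\<^sub>C x) = c *\<^sub>C f x" for c x
    by (simp add: f_def cblinfun_apply_scaleC_right)
  have inj: "y = y'" if y: "y \<in> range f" "y' \<in> range f" "f (f y) = f (f y')" for y y'
  proof -
    obtain u u' where u: "y = f u" "y' = f u'" using y by blast
    have "f (f (y - y')) = 0" using y(3) by (simp add: f.diff)
    then have "f (y - y') = 0" using null by (simp add: f_def)
    then have "f (f (u - u')) = 0" using u by (simp add: f.diff)
    then have "f (u - u') = 0" using null by (simp add: f_def)
    then show ?thesis using u by (simp add: f.diff)
  qed
  let ?F = "\<lambda>(u, v). u + f v" and ?S = "{p :: 'z \<times> 'z. f (fst p) = 0}"
  have F: "bounded_linear ?F"
    using bounded_linear_add[OF bounded_linear_fst bounded_linear_compose[OF f.bounded_linear_axioms bounded_linear_snd]]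
    by (simp add: case_prod_unfold)
  have "closed ?S"
    by (intro closed_Collect_eq continuous_intros bounded_linear.continuous_on[OF f.bounded_linear_axioms])
  moreover have "subspace ?S" by (auto simp: subspace_def f.add f.scaleR f.zero)
  moreover have "?F ` ?S = UNIV"
  proof -
    have "x \<in> ?F ` ?S" for x
    proof -
      obtain v where "f x = f (f v)" using range f_def by blast
      then show ?thesis by (intro image_eqI[of _ _ "(x - f v, v)"]) (simp_all add: f.diff)
    qed
    then show ?thesis by blast
  qed
  ultimately obtain K where K: "0 < K" "\<And>x. \<exists>p\<in>?S. ?F p = x \<and> norm p \<le> K * norm x"
    using open_mapping_bound[OF F] by blast
  have dec: "\<exists>u v. f u = 0 \<and> x = u + f v \<and> norm u \<le> K * norm x \<and> norm v \<le> K * norm x" for x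
  proof -
    obtain u v where "f u = 0" "u + f v = x" "norm (u, v) \<le> K * norm x" using K(2)[of x] by auto
    then show ?thesis
      using norm_fst_le[of u v] norm_snd_le[of v u] by (metis order_trans)
  qed
  \<comment> \<open>Decomposing \<open>x\<close> as u + f v and then \<open>v\<close> as u' + f v'
    gives y = f v' = v - u', whose norm is controlled by the norms of v and u'.\<close>
  have ex: "\<exists>y\<in>range f. f (f y) = f x \<and> norm y \<le> norm x * (K + K * K)" for x
  proof -
    obtain u v where u: "f u = 0" "x = u + f v" "norm v \<le> K * norm x" using dec by meson
    obtain u' v' where u': "f u' = 0" "v = u' + f v'" "norm u' \<le> K * norm v" using dec by meson
    have "norm (f v') \<le> norm v + norm u'"
      using u'(2) norm_triangle_ineq4[of v u'] by simp
    also have "\<dots> \<le> K * norm x + K * (K * norm x)"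
    proof -
      have "K * norm v \<le> K * (K * norm x)" using u(3) K(1) by (intro mult_left_mono) auto
      then show ?thesis using u(3) u'(3) by linarith
    qed
    finally have "norm (f v') \<le> norm x * (K + K * K)" by (simp add: algebra_simps)
    moreover have "f (f (f v')) = f x" using u u' by (simp add: f.add)
    ultimately show ?thesis by blast
  qed
  then obtain s where s: "\<And>x. s x \<in> range f" "\<And>x. f (f (s x)) = f x"
    "\<And>x. norm (s x) \<le> norm x * (K + K * K)" by metis
  have s_eq: "s x = y" if "y \<in> range f" "f (f y) = f x" for x y
    using inj[OF s(1) that(1)] that(2) s(2) by simp
  have range_add: "y + y' \<in> range f" if "y \<in> range f" "y' \<in> range f" for y y'
    using that by (auto simp flip: f.add)
  have range_scale: "c *\<^sub>C y \<in> range f" if "y \<in> range f" for y c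
    using that by (auto simp flip: f_scale)
  have s_add: "s (x + y) = s x + s y" for x y
    by (rule s_eq) (simp_all add: range_add s f.add)
  have s_scale: "s (c *\<^sub>C x) = c *\<^sub>C s x" for c x
    by (rule s_eq) (simp_all add: range_scale s f_scale)
  have "bounded_linear s"
    by (rule bounded_linear_intro[OF s_add _ s(3)]) (simp add: scaleR_scaleC s_scale)
  then obtain s' where s': "cblinfun_apply s' = s" using cblinfun_exI s_scale by blast
  have s_commute: "s (f x) = f (s x)" for x
    by (rule s_eq) (simp_all add: s)
  have "b o\<^sub>C s' = s' o\<^sub>C b"
    by (rule cblinfun_eqI) (simp add: cblinfun_apply_compose s' s_commute flip: f_def)
  moreover have "b o\<^sub>C b o\<^sub>C s' = b"
    by (rule cblinfun_eqI) (simp add: cblinfun_apply_compose s' s flip: f_def)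
  moreover have "s' o\<^sub>C s' o\<^sub>C b = s'"
  proof (rule cblinfun_eqI)
    fix x
    have "s (f (s x)) = s x"
      by (rule s_eq) (simp_all add: s)
    then show "cblinfun_apply (s' o\<^sub>C s' o\<^sub>C b) x = cblinfun_apply s' x"
      by (simp add: cblinfun_apply_compose s' s_commute flip: f_def)
  qed
  ultimately show ?thesis
    unfolding group_invertible_def by (metis Endo_compose)
qed

section \<open>Stabilising null spaces and ranges\<close>

lemma null_pow_stable:
  assumes "null_pow T n = null_pow T (n + 1)" and "n \<le> m"
  shows "null_pow T m = null_pow T n"
  using assms(2)
proof (induction m rule: dec_induct)
  case (step m)
  let ?f = "cblinfun_apply T"
  have eq: "(?f ^^ n) y = 0 \<longleftrightarrow> (?f ^^ Suc n) y = 0" for y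
    using assms(1) by (auto simp: null_pow_def set_eq_iff)
  have "(?f ^^ m) x = 0 \<longleftrightarrow> (?f ^^ Suc m) x = 0" for x
    using eq[of "(?f ^^ (m - n)) x"] step(1)
    by (metis Suc_diff_le add_Suc funpow_add le_add_diff_inverse o_apply)
  then have "null_pow T (Suc m) = null_pow T m" by (simp add: null_pow_def)
  with step.IH show ?case by simp
qed simp

lemma range_pow_stable:
  assumes "range_pow T n = range_pow T (n + 1)" and "n \<le> m"
  shows "range_pow T m = range_pow T n"
  using assms(2)
proof (induction m rule: dec_induct)
  case (step m)
  have "range_pow T (Suc k) = cblinfun_apply T ` range_pow T k" for k
    by (auto simp: range_pow_def)
  then show ?case using step.IH assms(1) by (metis Suc_eq_plus1)
qed simp

lemma ascent_finite: "ascent T < \<infinity> \<longleftrightarrow> (\<exists>n. null_pow T n = null_pow T (n + 1))"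
proof
  assume "ascent T < \<infinity>"
  then show "\<exists>n. null_pow T n = null_pow T (n + 1)"
    by (auto simp: ascent_def Inf_enat_def split: if_splits)
next
  assume "\<exists>n. null_pow T n = null_pow T (n + 1)"
  then obtain n where "null_pow T n = null_pow T (n + 1)" by blast
  then have "ascent T \<le> enat n" unfolding ascent_def by (intro Inf_lower) blast
  then show "ascent T < \<infinity>" by (metis enat_ord_simps(4) infinity_ileE less_le)
qed

lemma descent_finite: "descent T < \<infinity> \<longleftrightarrow> (\<exists>n. range_pow T n = range_pow T (n + 1))"
proof
  assume "descent T < \<infinity>"
  then show "\<exists>n. range_pow T n = range_pow T (n + 1)"
    by (auto simp: descent_def Inf_enat_def split: if_splits)
next
  assume "\<exists>n. range_pow T n = range_pow T (n + 1)"
  then obtain n where "range_pow T n = range_pow T (n + 1)" by blast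
  then have "descent T \<le> enat n" unfolding descent_def by (intro Inf_lower) blast
  then show "descent T < \<infinity>" by (metis enat_ord_simps(4) infinity_ileE less_le)
qed

lemma finite_ascent_descent:
  fixes T :: "('z::cbanach, 'z) cblinfun"
  assumes "ascent T < \<infinity>" and "descent T < \<infinity>"
  obtains p where "0 < p" and "group_invertible (Endo T ^ p)"
    and "null_pow T (p + 1) = null_pow T p" and "range_pow T (p + 1) = range_pow T p"
proof -
  obtain m n where m: "null_pow T m = null_pow T (m + 1)" and n: "range_pow T n = range_pow T (n + 1)"
    using assms unfolding ascent_finite descent_finite by blast
  \<comment> \<open>From max m n on, null spaces and ranges are constant, so T ^ p and its square
    share both. The successor ensures p > 0, which later places the p-th power of an element of an
    ideal in that ideal.\<close>
  define p where "p = Suc (max m n)"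
  have le: "m \<le> p" "n \<le> p" by (auto simp: p_def)
  have N: "null_pow T k = null_pow T p" and R: "range_pow T k = range_pow T p" if "p \<le> k" for k
    using null_pow_stable[OF m, of k] null_pow_stable[OF m, of p] range_pow_stable[OF n, of k]
      range_pow_stable[OF n, of p] that le by simp_all
  define b where "b = cblinfun_of_endo (Endo T ^ p)"
  have b: "cblinfun_apply b = cblinfun_apply T ^^ p"
    by (simp add: b_def cblinfun_apply_endo_power)
  have bb: "cblinfun_apply b (cblinfun_apply b x) = (cblinfun_apply T ^^ (p + p)) x" for x
    by (simp add: b funpow_add)
  have "group_invertible (Endo b)"
  proof (rule group_inverse_exists)
    show "cblinfun_apply b x = 0" if "cblinfun_apply b (cblinfun_apply b x) = 0" for x
    proof -
      have "x \<in> null_pow T (p + p)" using that by (simp only: bb null_pow_def mem_Collect_eq)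
      then have "x \<in> null_pow T p" using N[of "p + p"] by simp
      then show ?thesis by (simp only: b null_pow_def mem_Collect_eq)
    qed
    show "\<exists>v. cblinfun_apply b x = cblinfun_apply b (cblinfun_apply b v)" for x
    proof -
      have "(cblinfun_apply T ^^ p) x \<in> range_pow T p" by (simp only: range_pow_def rangeI)
      then have "(cblinfun_apply T ^^ p) x \<in> range_pow T (p + p)" using R[of "p + p"] by simp
      then show ?thesis unfolding bb unfolding b range_pow_def by blast
    qed
  qed
  then show thesis
    using N[of "p + 1"] R[of "p + 1"]
    by (intro that[of p]) (simp_all only: b_def cblinfun_of_endo_inverse p_def zero_less_Suc le_add1)
qed

text \<open>With the group inverse s of f = T ^ p, the bounded operator f s is a projection onto the
  range of f, which is thus a set of fixed points.\<close>

lemma closed_range_pow: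
  assumes "group_invertible (Endo T ^ p)"
  shows "closed (range_pow T p)"
proof -
  obtain s where s: "Endo T ^ p * s = s * Endo T ^ p" "Endo T ^ p * Endo T ^ p * s = Endo T ^ p"
    using assms by (auto simp: group_invertible_def)
  define f where "f = cblinfun_apply T ^^ p"
  define g where "g = cblinfun_apply (cblinfun_of_endo s)"
  have f: "f = cblinfun_apply (cblinfun_of_endo (Endo T ^ p))"
    by (simp add: f_def cblinfun_apply_endo_power)
  have "f (g (f x)) = f x" for x
  proof -
    have "Endo T ^ p * s * Endo T ^ p = Endo T ^ p" using s by (metis mult.assoc)
    then have "cblinfun_apply (cblinfun_of_endo (Endo T ^ p * s * Endo T ^ p)) x = f x"
      by (simp add: f)
    then show ?thesis by (simp add: times_endo.rep_eq cblinfun_apply_compose f g_def)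
  qed
  then have "range f = {x. f (g x) = x}" by (auto intro: rangeI) (metis rangeI)
  moreover have "closed {x. f (g x) = x}"
    unfolding f g_def
    by (intro closed_Collect_eq continuous_intros
        bounded_linear.continuous_on[OF bounded_linear_cblinfun_apply])
  ultimately show ?thesis by (simp add: range_pow_def f_def)
qed

section \<open>Poles and the B-Weyl spectrum\<close>

lemma has_cdim_0: "has_cdim {0} 0"
  unfolding has_cdim_def
  by (intro exI[of _ "{}"]) (simp add: complex_vector.independent_empty)

text \<open>On the range of T ^ p, with p as supplied by \<open>finite_ascent_descent\<close>, T is
  bijective, so the null space and the quotient both have dimension 0.\<close>

lemma finite_ascent_descent_B_weyl:
  fixes T :: "('z::cbanach, 'z) cblinfun"
  assumes "ascent T < \<infinity>" and "descent T < \<infinity>"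
  shows "B_weyl T"
proof -
  obtain p where p: "group_invertible (Endo T ^ p)"
    "null_pow T (p + 1) = null_pow T p" "range_pow T (p + 1) = range_pow T p"
    by (rule finite_ascent_descent[OF assms]) (rule that)
  let ?M = "range_pow T p"
  have "{x \<in> ?M. cblinfun_apply T x = 0} = {0}"
  proof -
    have "(cblinfun_apply T ^^ p) y = 0" if "cblinfun_apply T ((cblinfun_apply T ^^ p) y) = 0" for y
      using that p(2) by (auto simp: null_pow_def set_eq_iff)
    moreover have "(cblinfun_apply T ^^ k) 0 = 0" for k by (induction k) (simp_all add: cblinfun_apply_linear(3))
    then have "0 \<in> ?M" unfolding range_pow_def by (metis rangeI)
    ultimately show ?thesis by (auto simp: range_pow_def cblinfun_apply_linear(3))
  qed
  moreover have "cblinfun_apply T ` ?M = ?M"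
    using p(3) by (auto simp: range_pow_def image_def)
  moreover have "has_quotient_cdim ?M ?M 0"
    unfolding has_quotient_cdim_def by (intro exI[of _ "{}"]) simp
  ultimately have "weyl_on ?M T"
    unfolding weyl_on_def using has_cdim_0 by metis
  then show ?thesis unfolding B_weyl_def using closed_range_pow[OF p(1)] by blast
qed

text \<open>An invertible operator has ascent and descent 0 and is therefore B-Weyl.\<close>

lemma B_weyl_spectrum_subset_cspectrum: "B_weyl_spectrum T \<subseteq> cspectrum (T :: ('z::cbanach, 'z) cblinfun)"
proof
  fix \<mu> assume \<mu>: "\<mu> \<in> B_weyl_spectrum T"
  show "\<mu> \<in> cspectrum T"
  proof (rule ccontr)
    assume "\<mu> \<notin> cspectrum T"
    then obtain S where S: "S o\<^sub>C (T - \<mu> *\<^sub>C cblinfun_id) = cblinfun_id"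
        "(T - \<mu> *\<^sub>C cblinfun_id) o\<^sub>C S = cblinfun_id"
      by (auto simp: cspectrum_def)
    let ?T = "T - \<mu> *\<^sub>C cblinfun_id"
    have id: "cblinfun_apply cblinfun_id x = x" for x :: 'z
      by (rule cblinfun_apply_id)
    have ST: "cblinfun_apply S (cblinfun_apply ?T x) = x" "cblinfun_apply ?T (cblinfun_apply S x) = x" for x
      using S id by (metis cblinfun_apply_compose)+
    have "x = 0" if "cblinfun_apply ?T x = 0" for x using that ST(1) cblinfun_apply_linear(3) by metis
    then have "null_pow ?T 0 = null_pow ?T (0 + 1)" by (auto simp: null_pow_def cblinfun_apply_linear(3))
    moreover have "range_pow ?T 0 = range_pow ?T (0 + 1)"
    proof -
      have "x \<in> range (cblinfun_apply ?T)" for x using ST(2)[of x] by (metis rangeI)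
      then show ?thesis by (auto simp: range_pow_def)
    qed
    ultimately have "B_weyl ?T"
      by (intro finite_ascent_descent_B_weyl) (auto simp only: ascent_finite descent_finite)
    with \<mu> show False by (simp add: B_weyl_spectrum_def)
  qed
qed

text \<open>The B-Weyl spectrum always lies in the spectrum and never meets the poles; the remaining
  inclusion carries the content of the property.\<close>

lemma generalized_browder_iff:
  fixes T :: "('z::cbanach, 'z) cblinfun"
  shows "generalized_browder T \<longleftrightarrow> cspectrum T - B_weyl_spectrum T \<subseteq> poles T"
proof -
  have "B_weyl_spectrum T \<inter> poles T = {}"
    by (auto simp: poles_def B_weyl_spectrum_def intro: finite_ascent_descent_B_weyl)
  then show ?thesis
    using B_weyl_spectrum_subset_cspectrum[of T] by (auto simp: generalized_browder_def)
qed

text \<open>The equation read with \<open>a\<close> on the right equates the ranges of two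
  successive powers; moved to the left by commutation, \<open>a\<close> equates their null
  spaces.\<close>

lemma poleI:
  fixes T :: "('z::cbanach, 'z) cblinfun"
  assumes "\<mu> \<in> cspectrum T" and pow: "(Endo T - \<mu> *\<^sub>C 1) ^ n = (Endo T - \<mu> *\<^sub>C 1) ^ Suc n * a"
    and comm: "a * (Endo T - \<mu> *\<^sub>C 1) = (Endo T - \<mu> *\<^sub>C 1) * a"
  shows "\<mu> \<in> poles T"
proof -
  let ?T = "T - \<mu> *\<^sub>C cblinfun_id"
  define f where "f = cblinfun_apply ?T"
  define g where "g = cblinfun_apply (cblinfun_of_endo a)"
  have E: "Endo ?T = Endo T - \<mu> *\<^sub>C 1" by (simp add: Endo_diff Endo_scaleC Endo_id)
  have "(Endo T - \<mu> *\<^sub>C 1) ^ n = a * (Endo T - \<mu> *\<^sub>C 1) ^ Suc n"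
    using pow power_commuting_commutes[OF comm[symmetric], of "Suc n"] by metis
  then have "cblinfun_apply (cblinfun_of_endo (Endo ?T ^ n)) x
      = cblinfun_apply (cblinfun_of_endo (a * Endo ?T ^ Suc n)) x" for x
    unfolding E by simp
  then have l: "(f ^^ n) x = g ((f ^^ Suc n) x)" for x
    unfolding times_endo.rep_eq[of a] cblinfun_apply_compose cblinfun_apply_endo_power f_def g_def .
  have "cblinfun_apply (cblinfun_of_endo (Endo ?T ^ n)) x
      = cblinfun_apply (cblinfun_of_endo (Endo ?T ^ Suc n * a)) x" for x
    using pow unfolding E by simp
  then have r: "(f ^^ n) x = (f ^^ Suc n) (g x)" for x
    unfolding times_endo.rep_eq[of _ a] cblinfun_apply_compose cblinfun_apply_endo_power f_def g_def .
  have zero: "f 0 = 0" "g 0 = 0"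
    by (simp_all add: f_def g_def cblinfun_apply_linear(3))
  have "null_pow ?T n = null_pow ?T (n + 1)"
  proof -
    have "(f ^^ n) x = 0 \<longleftrightarrow> (f ^^ Suc n) x = 0" for x
      using l[of x] zero by auto
    then show ?thesis by (simp add: null_pow_def flip: f_def)
  qed
  moreover have "range_pow ?T n = range_pow ?T (n + 1)"
  proof -
    have "(f ^^ n) x \<in> range (f ^^ Suc n)" for x using r by (metis rangeI)
    moreover have "(f ^^ Suc n) x \<in> range (f ^^ n)" for x by (simp add: funpow_swap1)
    ultimately show ?thesis unfolding range_pow_def Suc_eq_plus1[symmetric] f_def[symmetric] by blast
  qed
  ultimately show ?thesis
    using assms(1) unfolding poles_def ascent_finite descent_finite by blast
qed

section \<open>Transfer to the product operators\<close>

text \<open>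
  Homomorphisms on commutative subalgebras: this covers left multiplication operators
  as well as right multiplication operators, which reverse products.
\<close>

definition commuting_hom :: "('a::cbanach_algebra \<Rightarrow> 'b::cbanach_algebra) \<Rightarrow> bool" where
  "commuting_hom H \<longleftrightarrow> H 1 = 1 \<and> (\<forall>x y. H (x - y) = H x - H y) \<and> (\<forall>c x. H (c *\<^sub>C x) = c *\<^sub>C H x) \<and>
    (\<forall>x y. x * y = y * x \<longrightarrow> H (x * y) = H x * H y)"

lemma commuting_homI:
  assumes "H 1 = 1" "\<And>x y. H (x - y) = H x - H y" "\<And>c x. H (c *\<^sub>C x) = c *\<^sub>C H x"
    "\<And>x y. x * y = y * x \<Longrightarrow> H (x * y) = H x * H y"
  shows "commuting_hom H"
  using assms by (auto simp: commuting_hom_def)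

lemma commuting_homD:
  assumes "commuting_hom H"
  shows "H 1 = 1" "H (x - y) = H x - H y" "H (c *\<^sub>C x) = c *\<^sub>C H x"
    "x * y = y * x \<Longrightarrow> H (x * y) = H x * H y"
  using assms by (auto simp: commuting_hom_def)

lemma commuting_hom_power: "commuting_hom H \<Longrightarrow> H (x ^ n) = H x ^ n"
  by (induction n) (simp_all add: commuting_homD power_commutes)

text \<open>The element and its group inverse commute, so every product in the defining equations is
  one of commuting factors.\<close>

lemma commuting_hom_group_invertible:
  assumes H: "commuting_hom H" and "group_invertible b"
  shows "group_invertible (H b)"
proof -
  obtain s where s: "b * s = s * b" "b * b * s = b" "s * s * b = s"
    using assms(2) by (auto simp: group_invertible_def)
  have "H b * H s = H s * H b" using commuting_homD(4)[OF H] s(1) by metis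
  moreover have "H b * H b * H s = H (b * b * s)" "H s * H s * H b = H (s * s * b)"
    using commuting_homD(4)[OF H] s(1) by (metis mult.assoc)+
  ultimately show ?thesis unfolding group_invertible_def using s(2,3) by metis
qed

lemma commuting_hom_invertible:
  assumes H: "commuting_hom H" and "b * z = 1" "z * b = 1"
  shows "H b * H z = 1 \<and> H z * H b = 1"
  using assms(2,3) commuting_homD(1,4)[OF H] by metis

lemma pole_group_invertible:
  fixes A :: "('z::cbanach, 'z) cblinfun"
  assumes "\<mu> \<in> poles A"
  shows "\<exists>i>0. group_invertible ((Endo A - \<mu> *\<^sub>C 1) ^ i)"
proof -
  have "ascent (A - \<mu> *\<^sub>C cblinfun_id) < \<infinity>" "descent (A - \<mu> *\<^sub>C cblinfun_id) < \<infinity>"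
    using assms by (auto simp: poles_def)
  then obtain p where "0 < p" "group_invertible (Endo (A - \<mu> *\<^sub>C cblinfun_id) ^ p)"
    by (rule finite_ascent_descent) (rule that)
  then show ?thesis by (auto simp: Endo_diff Endo_scaleC Endo_id)
qed

text \<open>\<open>H\<close> and \<open>K\<close> preserve inverses, so the spectra of the two
  images lie in those of \<open>A\<close> and \<open>B\<close>; they also preserve group inverses,
  so the poles of \<open>A\<close> and \<open>B\<close> supply what
  \<open>commuting_product_power\<close> asks for.\<close>

theorem generalized_browder_product:
  fixes A :: "('x::cbanach, 'x) cblinfun" and B :: "('y::cbanach, 'y) cblinfun"
    and T :: "('z::cbanach, 'z) cblinfun"
  assumes H: "commuting_hom H" and K: "commuting_hom K"
    and comm: "H (Endo A) * K (Endo B) = K (Endo B) * H (Endo A)"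
    and T: "Endo T = H (Endo A) * K (Endo B)"
    and gB: "generalized_browder A" "generalized_browder B"
    and sub: "cspectrum A * B_weyl_spectrum B \<union> B_weyl_spectrum A * cspectrum B \<subseteq> B_weyl_spectrum T"
  shows "generalized_browder T"
  unfolding generalized_browder_iff
proof
  fix \<zeta> assume \<zeta>: "\<zeta> \<in> cspectrum T - B_weyl_spectrum T"
  have Hs: "H (Endo A - \<mu> *\<^sub>C 1) = H (Endo A) - \<mu> *\<^sub>C 1"
    and Ks: "K (Endo B - \<mu> *\<^sub>C 1) = K (Endo B) - \<mu> *\<^sub>C 1" for \<mu>
    by (simp_all add: commuting_homD[OF H] commuting_homD[OF K])
  have "\<exists>n a. (H (Endo A) * K (Endo B) - \<zeta> *\<^sub>C 1) ^ n = (H (Endo A) * K (Endo B) - \<zeta> *\<^sub>C 1) ^ Suc n * a \<and>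
    a * (H (Endo A) * K (Endo B) - \<zeta> *\<^sub>C 1) = (H (Endo A) * K (Endo B) - \<zeta> *\<^sub>C 1) * a"
  proof (rule commuting_product_power[OF comm])
    fix \<mu> \<nu> assume prod: "\<mu> * \<nu> = \<zeta>"
      and nP: "\<nexists>z. (H (Endo A) - \<mu> *\<^sub>C 1) * z = 1 \<and> z * (H (Endo A) - \<mu> *\<^sub>C 1) = 1"
      and nQ: "\<nexists>z. (K (Endo B) - \<nu> *\<^sub>C 1) * z = 1 \<and> z * (K (Endo B) - \<nu> *\<^sub>C 1) = 1"
    have \<mu>: "\<mu> \<in> cspectrum A"
      unfolding cspectrum_endo using nP commuting_hom_invertible[OF H] Hs by metis
    have \<nu>: "\<nu> \<in> cspectrum B"
      unfolding cspectrum_endo using nQ commuting_hom_invertible[OF K] Ks by metis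
    \<comment> \<open>Otherwise \<zeta> = \<mu> \<nu> would lie in the B-Weyl spectrum of
      \<open>T\<close> by \<open>sub\<close>.\<close>
    have "\<mu> \<notin> B_weyl_spectrum A" "\<nu> \<notin> B_weyl_spectrum B"
      using \<zeta> sub \<mu> \<nu> prod set_times_intro by blast+
    then have "\<mu> \<in> poles A" "\<nu> \<in> poles B"
      using gB \<mu> \<nu> by (auto simp: generalized_browder_def)
    then obtain i j where ij: "i > 0" "group_invertible ((Endo A - \<mu> *\<^sub>C 1) ^ i)"
        "j > 0" "group_invertible ((Endo B - \<nu> *\<^sub>C 1) ^ j)"
      using pole_group_invertible by meson
    have "group_invertible ((H (Endo A) - \<mu> *\<^sub>C 1) ^ i)"
      using commuting_hom_group_invertible[OF H ij(2)] by (simp add: commuting_hom_power[OF H] Hs)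
    moreover have "group_invertible ((K (Endo B) - \<nu> *\<^sub>C 1) ^ j)"
      using commuting_hom_group_invertible[OF K ij(4)] by (simp add: commuting_hom_power[OF K] Ks)
    ultimately show "(\<exists>i>0. group_invertible ((H (Endo A) - \<mu> *\<^sub>C 1) ^ i)) \<and>
        (\<exists>j>0. group_invertible ((K (Endo B) - \<nu> *\<^sub>C 1) ^ j))"
      using ij by blast
  qed
  then show "\<zeta> \<in> poles T" using poleI[of \<zeta> T] \<zeta> unfolding T by blast
qed

section \<open>Multiplication operators\<close>

lemma cblinfun_id_compose: "cblinfun_id o\<^sub>C A = A" "A o\<^sub>C cblinfun_id = A"
  by (rule cblinfun_eqI; simp add: cblinfun_apply_compose cblinfun_apply_id)+

lemma cblinfun_of_endo_simps:
  "cblinfun_of_endo 1 = cblinfun_id"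
  "cblinfun_of_endo (x * y) = cblinfun_of_endo x o\<^sub>C cblinfun_of_endo y"
  "cblinfun_of_endo (x - y) = cblinfun_of_endo x - cblinfun_of_endo y"
  "cblinfun_of_endo (c *\<^sub>C x) = c *\<^sub>C cblinfun_of_endo x"
  "cblinfun_of_endo (Endo T) = T"
  by (simp_all add: one_endo.rep_eq times_endo.rep_eq minus_endo.rep_eq scaleC_endo.rep_eq
      Endo_inverse)

lemma mult_op_apply_apply:
  "cblinfun_apply (cblinfun_apply (mult_op A B) U) x = cblinfun_apply A (cblinfun_apply U (cblinfun_apply B x))"
  by (simp add: mult_op_apply cblinfun_apply_compose)

lemma mult_op_compose: "mult_op A B o\<^sub>C mult_op A' B' = mult_op (A o\<^sub>C A') (B' o\<^sub>C B)"
  by (rule cblinfun_eqI, rule cblinfun_eqI) (simp add: cblinfun_apply_compose mult_op_apply_apply)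

lemma mult_op_linear:
  "mult_op (A - A') B = mult_op A B - mult_op A' B" "mult_op A (B - B') = mult_op A B - mult_op A B'"
  "mult_op (c *\<^sub>C A) B = c *\<^sub>C mult_op A B" "mult_op A (c *\<^sub>C B) = c *\<^sub>C mult_op A B"
  "mult_op cblinfun_id cblinfun_id = cblinfun_id"
  by (rule cblinfun_eqI, rule cblinfun_eqI, simp add: mult_op_apply_apply cblinfun_apply_diff
        cblinfun_apply_scaleC cblinfun_apply_linear cblinfun_apply_scaleC_right cblinfun_apply_id)+

lemma generalized_browder_mult_op:
  fixes A :: "('x::cbanach, 'x) cblinfun" and B :: "('y::cbanach, 'y) cblinfun"
  assumes "generalized_browder A" "generalized_browder B"
    and "cspectrum A * B_weyl_spectrum B \<union> B_weyl_spectrum A * cspectrum B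
      \<subseteq> B_weyl_spectrum (mult_op A B)"
  shows "generalized_browder (mult_op A B)"
proof (rule generalized_browder_product[OF _ _ _ _ assms])
  let ?H = "\<lambda>a. Endo (mult_op (cblinfun_of_endo a) (cblinfun_id :: ('y, 'y) cblinfun))"
  let ?K = "\<lambda>b. Endo (mult_op (cblinfun_id :: ('x, 'x) cblinfun) (cblinfun_of_endo b))"
  show "commuting_hom ?H"
  proof (rule commuting_homI)
    show "?H (x * y) = ?H x * ?H y" for x y
      by (simp add: cblinfun_of_endo_simps mult_op_compose cblinfun_id_compose flip: Endo_compose)
  qed (simp_all add: cblinfun_of_endo_simps mult_op_linear Endo_id Endo_diff Endo_scaleC)
  show "commuting_hom ?K"
  proof (rule commuting_homI)
    show "?K (x * y) = ?K x * ?K y" if "x * y = y * x" for x y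
      \<comment> \<open>Right multiplication reverses products, so the commuting factors are
        exchanged beforehand.\<close>
      unfolding that
      by (simp add: cblinfun_of_endo_simps mult_op_compose cblinfun_id_compose flip: Endo_compose)
  qed (simp_all add: cblinfun_of_endo_simps mult_op_linear Endo_id Endo_diff Endo_scaleC)
  show "?H (Endo A) * ?K (Endo B) = ?K (Endo B) * ?H (Endo A)"
    "Endo (mult_op A B) = ?H (Endo A) * ?K (Endo B)"
    by (simp_all add: cblinfun_of_endo_simps mult_op_compose cblinfun_id_compose flip: Endo_compose)
qed

section \<open>Tensor product operators on the completion\<close>

lemma tensor_linear:
  "(x + x') \<otimes>\<^sub>C y = x \<otimes>\<^sub>C y + x' \<otimes>\<^sub>C y" "x \<otimes>\<^sub>C (y + y') = x \<otimes>\<^sub>C y + x \<otimes>\<^sub>C y'"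
  "(c *\<^sub>C x) \<otimes>\<^sub>C y = c *\<^sub>C (x \<otimes>\<^sub>C y)" "x \<otimes>\<^sub>C (c *\<^sub>C y) = c *\<^sub>C (x \<otimes>\<^sub>C y)"
  by (rule ctensor_eqI; simp add: tensor.rep_eq tensor_sum_def plus_ctensor.rep_eq
      scaleC_ctensor.rep_eq bilinear_form_simps)+

lemma tensor_diff:
  "(x - x') \<otimes>\<^sub>C y = x \<otimes>\<^sub>C y - x' \<otimes>\<^sub>C y" "x \<otimes>\<^sub>C (y - y') = x \<otimes>\<^sub>C y - x \<otimes>\<^sub>C y'"
  using tensor_linear(1)[of "x - x'" x' y] tensor_linear(2)[of x "y - y'" y']
  by (simp_all add: eq_diff_eq)

lemma generalized_browder_tensor_op:
  fixes A :: "('x::cbanach, 'x) cblinfun" and B :: "('y::cbanach, 'y) cblinfun"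
    and \<iota> :: "('x, 'y) ctensor \<Rightarrow> 'z::cbanach"
  assumes \<alpha>: "reasonable_uniform_crossnorm \<alpha>" "is_completion \<alpha> \<iota>"
    and gB: "generalized_browder A" "generalized_browder B"
    and sub: "cspectrum A * B_weyl_spectrum B \<union> B_weyl_spectrum A * cspectrum B
      \<subseteq> B_weyl_spectrum (tensor_op \<iota> A B)"
  shows "generalized_browder (tensor_op \<iota> A B)"
proof -
  have "module_hom scaleC scaleC \<iota>"
    using \<alpha>(2) by (auto simp: is_completion_def dest: Vector_Spaces.linear.axioms(3))
  then have \<iota>: "\<iota> (u + v) = \<iota> u + \<iota> v" "\<iota> (c *\<^sub>C u) = c *\<^sub>C \<iota> u" for u v c
    by (simp_all add: module_hom_iff)
  have \<iota>_diff: "\<iota> (u - v) = \<iota> u - \<iota> v" for u v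
    using \<iota>(1)[of "u - v" v] by simp
  have app: "cblinfun_apply (tensor_op \<iota> F G) (\<iota> (x \<otimes>\<^sub>C y)) = \<iota> (cblinfun_apply F x \<otimes>\<^sub>C cblinfun_apply G y)"
    for F G x y
    using theI'[OF tensor_op_ex1[OF \<alpha>, of F G]] by (simp add: tensor_op_def)
  \<comment> \<open>Operators on the completion are determined by their values on elementary
    tensors, so the algebraic identities below need to be checked only there.\<close>
  have eqI: "tensor_op \<iota> F G = S"
    if "\<And>x y. cblinfun_apply S (\<iota> (x \<otimes>\<^sub>C y)) = \<iota> (cblinfun_apply F x \<otimes>\<^sub>C cblinfun_apply G y)" for F G S
    using tensor_op_ex1[OF \<alpha>, of F G] app that by blast
  have compose: "tensor_op \<iota> F G o\<^sub>C tensor_op \<iota> F' G' = tensor_op \<iota> (F o\<^sub>C F') (G o\<^sub>C G')" for F F' G G'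
    by (rule eqI[symmetric]) (simp add: cblinfun_apply_compose app)
  have linear: "tensor_op \<iota> (F - F') G = tensor_op \<iota> F G - tensor_op \<iota> F' G"
    "tensor_op \<iota> F (G - G') = tensor_op \<iota> F G - tensor_op \<iota> F G'"
    "tensor_op \<iota> (c *\<^sub>C F) G = c *\<^sub>C tensor_op \<iota> F G"
    "tensor_op \<iota> F (c *\<^sub>C G) = c *\<^sub>C tensor_op \<iota> F G"
    "tensor_op \<iota> cblinfun_id cblinfun_id = cblinfun_id" for F F' G G' c
    by (rule eqI; simp add: app cblinfun_apply_diff cblinfun_apply_scaleC tensor_linear tensor_diff \<iota>
        \<iota>_diff cblinfun_apply_id)+
  let ?H = "\<lambda>a. Endo (tensor_op \<iota> (cblinfun_of_endo a) cblinfun_id)"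
  let ?K = "\<lambda>b. Endo (tensor_op \<iota> cblinfun_id (cblinfun_of_endo b))"
  show ?thesis
  proof (rule generalized_browder_product[OF _ _ _ _ gB sub])
    show "commuting_hom ?H"
    proof (rule commuting_homI)
      show "?H (x * y) = ?H x * ?H y" for x y
        by (simp add: cblinfun_of_endo_simps compose cblinfun_id_compose flip: Endo_compose)
    qed (simp_all add: cblinfun_of_endo_simps linear Endo_id Endo_diff Endo_scaleC)
    show "commuting_hom ?K"
    proof (rule commuting_homI)
      show "?K (x * y) = ?K x * ?K y" for x y
        by (simp add: cblinfun_of_endo_simps compose cblinfun_id_compose flip: Endo_compose)
    qed (simp_all add: cblinfun_of_endo_simps linear Endo_id Endo_diff Endo_scaleC)
    show "?H (Endo A) * ?K (Endo B) = ?K (Endo B) * ?H (Endo A)"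
      "Endo (tensor_op \<iota> A B) = ?H (Endo A) * ?K (Endo B)"
      by (simp_all add: cblinfun_of_endo_simps compose cblinfun_id_compose flip: Endo_compose)
  qed
qed

theorem theorem4p2:
  fixes A :: "('x::cbanach, 'x) cblinfun" and B :: "('y::cbanach, 'y) cblinfun"
    and \<alpha> :: "('x, 'y) ctensor \<Rightarrow> real" and \<iota> :: "('x, 'y) ctensor \<Rightarrow> 'z::cbanach"
  assumes infinite_dim_X: "\<nexists>n. has_cdim (UNIV :: 'x set) n"
    and infinite_dim_Y: "\<nexists>n. has_cdim (UNIV :: 'y set) n"
    and gBt_A: "generalized_browder A"
    and gBt_B: "generalized_browder B"
  shows "(reasonable_uniform_crossnorm \<alpha> \<and> is_completion \<alpha> \<iota> \<longrightarrow>
           cspectrum A * B_weyl_spectrum B \<union> B_weyl_spectrum A * cspectrum B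
             \<subseteq> B_weyl_spectrum (tensor_op \<iota> A B) \<longrightarrow>
           generalized_browder (tensor_op \<iota> A B)) \<and>
         (cspectrum A * B_weyl_spectrum B \<union> B_weyl_spectrum A * cspectrum B
             \<subseteq> B_weyl_spectrum (mult_op A B) \<longrightarrow>
           generalized_browder (mult_op A B))"
  using generalized_browder_tensor_op[OF _ _ gBt_A gBt_B] generalized_browder_mult_op[OF gBt_A gBt_B]
  by blast

end
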